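(* Let $(\Omega,\mathscr{H},\widehat{\mathbb E})$ be a sub-linear expectation space over a measurable space $(\Omega,\mathcal F)$, with upper capacity $\mathbb V$, and suppose that $\mathbb V$ is countably sub-additive. Let $\{X_n;n\ge 1\}$ be a sequence of independent random variables in $(\Omega,\mathscr{H},\widehat{\mathbb E})$. For a constant $c>0$ write $X_n^c=(-c)\vee(X_n\wedge c)$ and consider the three conditions (S1) $\sum_{n=1}^\infty \mathbb V(|X_n|>c)<\infty$; (S2) $\sum_{n=1}^\infty\widehat{\mathbb E}[X_n^c]$ and $\sum_{n=1}^\infty\widehat{\mathbb E}[-X_n^c]$ are both convergent; (S3) $\sum_{n=1}^\infty\widehat{\mathbb E}\big[(X_n^c-\widehat{\mathbb E}[X_n^c])^2\big]<\infty$ or/and $\sum_{n=1}^\infty\widehat{\mathbb E}\big[(X_n^c+\widehat{\mathbb E}[-X_n^c])^2\big]<\infty$ (that is, at least one of the two series is finite). If (S1), (S2) and (S3) hold for some $c>0$, then $\sum_{n=1}^\infty X_n$ converges almost surely in capacity. Conversely, if $\mathbb V$ is continuous and $\sum_{n=1}^\infty X_n$ is convergent almost surely in capacity, then (S1), (S2) and (S3) hold for all $c>0$.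
   Context: Framework. $(\Omega,\mathcal F)$ is a measurable space and $\mathscr{H}$ is a linear space of real ($\mathcal F$-measurable) functions on $\Omega$ such that $X_1,\dots,X_n\in\mathscr{H}$ implies $\varphi(X_1,\dots,X_n)\in\mathscr{H}$ for every $\varphi\in C_{l,Lip}(\mathbb R^n)$, where $C_{l,Lip}(\mathbb R^n)$ is the space of functions $\varphi$ with $|\varphi(x)-\varphi(y)|\le C(1+|x|^m+|y|^m)|x-y|$ for all $x,y\in\mathbb R^n$, for some $C>0$, $m\in\mathbb N$ depending on $\varphi$. Elements of $\mathscr{H}$ are the random variables in the space. A sub-linear expectation on $\mathscr{H}$ is a function $\widehat{\mathbb E}:\mathscr{H}\to[-\infty,\infty]$ such that for all $X,Y\in\mathscr{H}$: (a) $X\ge Y$ implies $\widehat{\mathbb E}[X]\ge\widehat{\mathbb E}[Y]$; (b) $\widehat{\mathbb E}[c]=c$ for constants $c$; (c) $\widehat{\mathbb E}[X+Y]\le\widehat{\mathbb E}[X]+\widehat{\mathbb E}[Y]$ whenever the right side is not of the form $+\infty-\infty$ or $-\infty+\infty$; (d) $\widehat{\mathbb E}[\lambda X]=\lambda\widehat{\mathbb E}[X]$ for $\lambda\ge 0$. The triple $(\Omega,\mathscr{H},\widehat{\mathbb E})$ is called a sub-linear expectation space. Capacity. $\mathbb V(A):=\inf\{\widehat{\mathbb E}[\xi]: I_A\le\xi,\ \xi\in\mathscr{H}\}$ for $A\in\mathcal F$. $\mathbb V$ is countably sub-additive if $\mathbb V(\bigcup_{n=1}^\infty A_n)\le\sum_{n=1}^\infty\mathbb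 V(A_n)$ for all $A_n\in\mathcal F$. $\mathbb V$ is continuous if $\mathbb V(A_n)\uparrow\mathbb V(A)$ whenever $A_n\uparrow A$, and $\mathbb V(A_n)\downarrow\mathbb V(A)$ whenever $A_n\downarrow A$ ($A_n,A\in\mathcal F$). Independence. Let $C_{b,Lip}$ denote bounded Lipschitz functions. A random vector $Y=(Y_1,\dots,Y_n)$ ($Y_i\in\mathscr{H}$) is independent to $X=(X_1,\dots,X_m)$ ($X_i\in\mathscr{H}$) if $\widehat{\mathbb E}[\varphi(X,Y)]=\widehat{\mathbb E}\big[\widehat{\mathbb E}[\varphi(x,Y)]|_{x=X}\big]$ for all $\varphi\in C_{b,Lip}(\mathbb R^m\times\mathbb R^n)$. Random variables $\{X_n;n\ge1\}$ are independent if $X_{i+1}$ is independent to $(X_1,\dots,X_i)$ for each $i\ge1$. Almost sure convergence in capacity. With $S_n=\sum_{k=1}^nX_k$, the series $\sum_{n=1}^\infty X_n$ is (convergent) almost surely in capacity if there is a random variable $S$ on $(\Omega,\mathcal F)$ (a real $\mathcal F$-measurable function, not necessarily in $\mathscr{H}$) such that $\mathbb V\big(\{\omega:\lim_{n\to\infty}S_n(\omega)\ne S(\omega)\}\big)=0$, where $\{\lim_n S_n\ne S\}$ is the complement of the event that $S_n(\omega)$ converges to $S(\omega)$. *)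

theory Defs
  imports "HOL-Analysis.Analysis"
begin

(* The dimension varies inside the definitions below, so a vector of R^n is represented by a
   sequence nat => real of which only the coordinates i < n matter. The growth and Lipschitz
   conditions use the Euclidean norm of these coordinates only; hence they force a member of the
   function classes to be independent of the other coordinates. *)

abbreviation enorm :: "nat \<Rightarrow> (nat \<Rightarrow> real) \<Rightarrow> real" where
  "enorm n x \<equiv> L2_set x {..<n}"

definition C_l_Lip :: "nat \<Rightarrow> ((nat \<Rightarrow> real) \<Rightarrow> real) set" where
  "C_l_Lip n = {\<phi>. \<exists>C>0. \<exists>m::nat. \<forall>x y.
     \<bar>\<phi> x - \<phi> y\<bar> \<le> C * (1 + enorm n x ^ m + enorm n y ^ m) * enorm n (\<lambda>i. x i - y i)}"

(* Bounded Lipschitz functions on R^m x R^n, in curried form. *)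
definition C_b_Lip :: "nat \<Rightarrow> nat \<Rightarrow> ((nat \<Rightarrow> real) \<Rightarrow> (nat \<Rightarrow> real) \<Rightarrow> real) set" where
  "C_b_Lip m n = {\<phi>. (\<exists>B. \<forall>x y. \<bar>\<phi> x y\<bar> \<le> B) \<and>
     (\<exists>C. \<forall>x y x' y'. \<bar>\<phi> x y - \<phi> x' y'\<bar>
        \<le> C * sqrt ((enorm m (\<lambda>i. x i - x' i))\<^sup>2 + (enorm n (\<lambda>i. y i - y' i))\<^sup>2))}"

(* The sample space is space M. Functions are total on the ambient type, but everything is compared
   on space M only; by monotonicity E depends only on the values there. The values of E outside H
   are irrelevant. The premise of E_subadd says that the right-hand side is not of the form
   infinity - infinity; in E_scale the convention 0 * infinity = 0 applies. *)
locale sublinear_expectation_space =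
  fixes M :: "'a measure"
    and H :: "('a \<Rightarrow> real) set"
    and E :: "('a \<Rightarrow> real) \<Rightarrow> ereal"
  assumes H_measurable: "H \<subseteq> borel_measurable M"
    and H_zero: "(\<lambda>\<omega>. 0) \<in> H"
    and H_add: "X \<in> H \<Longrightarrow> Y \<in> H \<Longrightarrow> (\<lambda>\<omega>. X \<omega> + Y \<omega>) \<in> H"
    and H_scale: "X \<in> H \<Longrightarrow> (\<lambda>\<omega>. a * X \<omega>) \<in> H"
    and H_comp: "(\<And>i. i < n \<Longrightarrow> Z i \<in> H) \<Longrightarrow> \<phi> \<in> C_l_Lip n \<Longrightarrow> (\<lambda>\<omega>. \<phi> (\<lambda>i. Z i \<omega>)) \<in> H"
    and E_mono: "X \<in> H \<Longrightarrow> Y \<in> H \<Longrightarrow> (\<And>\<omega>. \<omega> \<in> space M \<Longrightarrow> Y \<omega> \<le> X \<omega>) \<Longrightarrow> E Y \<le> E X"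
    and E_const: "E (\<lambda>\<omega>. a) = ereal a"
    and E_subadd: "X \<in> H \<Longrightarrow> Y \<in> H \<Longrightarrow>
          \<not> (E X = \<infinity> \<and> E Y = -\<infinity>) \<Longrightarrow> \<not> (E X = -\<infinity> \<and> E Y = \<infinity>) \<Longrightarrow>
          E (\<lambda>\<omega>. X \<omega> + Y \<omega>) \<le> E X + E Y"
    and E_scale: "X \<in> H \<Longrightarrow> a \<ge> 0 \<Longrightarrow> E (\<lambda>\<omega>. a * X \<omega>) = ereal a * E X"

definition upper_capacity ::
  "'a measure \<Rightarrow> ('a \<Rightarrow> real) set \<Rightarrow> (('a \<Rightarrow> real) \<Rightarrow> ereal) \<Rightarrow> 'a set \<Rightarrow> ereal" where
  "upper_capacity M H E A = Inf {E \<xi> |\<xi>. \<xi> \<in> H \<and> (\<forall>\<omega>\<in>space M. indicator A \<omega> \<le> \<xi> \<omega>)}"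

definition countably_subadditive_capacity :: "'a measure \<Rightarrow> ('a set \<Rightarrow> ereal) \<Rightarrow> bool" where
  "countably_subadditive_capacity M V \<longleftrightarrow>
     (\<forall>A :: nat \<Rightarrow> 'a set. range A \<subseteq> sets M \<longrightarrow> V (\<Union>n. A n) \<le> (\<Sum>n. V (A n)))"

definition continuous_capacity :: "'a measure \<Rightarrow> ('a set \<Rightarrow> ereal) \<Rightarrow> bool" where
  "continuous_capacity M V \<longleftrightarrow>
     (\<forall>A :: nat \<Rightarrow> 'a set. range A \<subseteq> sets M \<longrightarrow> incseq A \<longrightarrow>
        (\<lambda>n. V (A n)) \<longlonglongrightarrow> V (\<Union>n. A n)) \<and>
     (\<forall>A :: nat \<Rightarrow> 'a set. range A \<subseteq> sets M \<longrightarrow> decseq A \<longrightarrow>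
        (\<lambda>n. V (A n)) \<longlonglongrightarrow> V (\<Inter>n. A n))"

(* The random vector (Y 0, ..., Y (n - 1)) is independent to (X 0, ..., X (m - 1)).
   The inner expectation is that of a bounded element of H, hence a real number, so that
   real_of_ereal loses nothing; the same holds for the truncated variables below. *)
definition independent_to ::
  "(('a \<Rightarrow> real) \<Rightarrow> ereal) \<Rightarrow> nat \<Rightarrow> (nat \<Rightarrow> 'a \<Rightarrow> real) \<Rightarrow> nat \<Rightarrow> (nat \<Rightarrow> 'a \<Rightarrow> real) \<Rightarrow> bool" where
  "independent_to E n Y m X \<longleftrightarrow>
     (\<forall>\<phi>\<in>C_b_Lip m n.
        E (\<lambda>\<omega>. \<phi> (\<lambda>i. X i \<omega>) (\<lambda>i. Y i \<omega>)) =
        E (\<lambda>\<omega>. real_of_ereal (E (\<lambda>\<omega>'. \<phi> (\<lambda>i. X i \<omega>) (\<lambda>i. Y i \<omega>')))))"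

(* Sequences are indexed from 0: X k stands for the (k+1)-st variable. *)
definition independent_sequence :: "(('a \<Rightarrow> real) \<Rightarrow> ereal) \<Rightarrow> (nat \<Rightarrow> 'a \<Rightarrow> real) \<Rightarrow> bool" where
  "independent_sequence E X \<longleftrightarrow> (\<forall>i\<ge>1. independent_to E 1 (\<lambda>_. X i) i X)"

definition series_converges_as ::
  "'a measure \<Rightarrow> ('a set \<Rightarrow> ereal) \<Rightarrow> (nat \<Rightarrow> 'a \<Rightarrow> real) \<Rightarrow> bool" where
  "series_converges_as M V X \<longleftrightarrow>
     (\<exists>S\<in>borel_measurable M.
        V {\<omega> \<in> space M. \<not> (\<lambda>n. \<Sum>k<n. X k \<omega>) \<longlonglongrightarrow> S \<omega>} = 0)"

definition trunc :: "real \<Rightarrow> ('a \<Rightarrow> real) \<Rightarrow> 'a \<Rightarrow> real" where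
  "trunc c X \<omega> = max (- c) (min (X \<omega>) c)"

definition S1 :: "'a measure \<Rightarrow> ('a set \<Rightarrow> ereal) \<Rightarrow> (nat \<Rightarrow> 'a \<Rightarrow> real) \<Rightarrow> real \<Rightarrow> bool" where
  "S1 M V X c \<longleftrightarrow> (\<Sum>n. V {\<omega> \<in> space M. \<bar>X n \<omega>\<bar> > c}) < \<infinity>"

definition S2 :: "(('a \<Rightarrow> real) \<Rightarrow> ereal) \<Rightarrow> (nat \<Rightarrow> 'a \<Rightarrow> real) \<Rightarrow> real \<Rightarrow> bool" where
  "S2 E X c \<longleftrightarrow>
     summable (\<lambda>n. real_of_ereal (E (trunc c (X n)))) \<and>
     summable (\<lambda>n. real_of_ereal (E (\<lambda>\<omega>. - trunc c (X n) \<omega>)))"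

definition S3 :: "(('a \<Rightarrow> real) \<Rightarrow> ereal) \<Rightarrow> (nat \<Rightarrow> 'a \<Rightarrow> real) \<Rightarrow> real \<Rightarrow> bool" where
  "S3 E X c \<longleftrightarrow>
     (\<Sum>n. E (\<lambda>\<omega>. (trunc c (X n) \<omega> - real_of_ereal (E (trunc c (X n))))\<^sup>2)) < \<infinity> \<or>
     (\<Sum>n. E (\<lambda>\<omega>. (trunc c (X n) \<omega> + real_of_ereal (E (\<lambda>\<omega>'. - trunc c (X n) \<omega>')))\<^sup>2)) < \<infinity>"

end

theory Submission
  imports Defs
begin

text \<open>
  An independent sequence enters the argument only through its law, the functional
  \<open>f \<mapsto> E (f (X 0, X 1, ...))\<close> on bounded Lipschitz functions \<open>f\<close> of finitely many coordinates.
  This is a real-valued sublinear functional, and independence says that it may be evaluated one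
  coordinate at a time, from the last one backwards (\<open>iterated_expectation\<close>). Capacities are compared
  with it by sandwiching indicators between such functions. The growth of a sum of variables is
  therefore controlled by inequalities for a single variable, with the past frozen, and all cutoffs
  have to be Lipschitz.

  Sufficiency. Put \<open>\<mu> k\<close> and \<open>\<nu> k\<close> for the upper expectations of the truncated variable and of its
  negative. The variables centred at \<open>\<mu> k\<close>, and the negatives centred at \<open>\<nu> k\<close>, have upper mean zero,
  but their lower means may be negative, so that only products with nonnegative functions of the past
  vanish under the expectation. This suffices for a one-sided Kolmogorov inequality: the sum is stopped
  softly when it becomes large, and the square of the positive part of the stopped sum is expanded; its
  mixed term has a nonnegative factor (\<open>maximal_inequality\<close>). The inequality for both one-sided sums
  and the convergence of the series of \<open>\<mu> k + \<nu> k\<close> control the oscillation in both directions.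
  Since the capacity need not be continuous from below, the inequality is applied along finite blocks
  whose capacities are summable, and countable subadditivity gives a Borel--Cantelli lemma.

  Necessity. Continuity from above makes the capacity of a large oscillation after time \<open>m\<close> tend to
  zero. The lower expectation of a product of nonnegative functions of different variables is the
  product of their lower expectations; this bounds the series of \<open>V (\<bar>X k\<bar> > c)\<close>. For the truncated
  variables, choose for each \<open>k\<close> a linear functional below the law of the \<open>k\<close>-th variable on polynomials
  of degree at most four (Hahn--Banach in finite dimension). Iterating these functionals gives a lower bound
  for the law on polynomials of a partial sum, in terms of honest moments of sums of independent centred
  variables (\<open>dominated_moments_sum\<close>). Such a sum with large variance is not concentrated near any
  constant, as explicit polynomials of degree at most four show; since the partial sums are concentrated,
  the variances are summable and the means form a convergent series (\<open>concentrated_imp_summable\<close>).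
  Three choices of functionals, those that maximise the mean, minimise the mean and maximise the second
  moment, give the two mean series and the variance series.
\<close>

section \<open>Linear functionals below a sublinear functional\<close>

definition sublinear :: "('v::real_vector \<Rightarrow> real) \<Rightarrow> bool" where
  "sublinear p \<longleftrightarrow> (\<forall>x y. p (x + y) \<le> p x + p y) \<and> (\<forall>a\<ge>0. \<forall>x. p (a *\<^sub>R x) = a * p x)"

lemma sublinear_zero: "sublinear p \<Longrightarrow> p 0 = 0"
  unfolding sublinear_def by (metis order.refl mult_zero_left scaleR_zero_left)

lemma sublinear_neg: "sublinear p \<Longrightarrow> - p (- x) \<le> p x"
  using sublinear_zero[of p] unfolding sublinear_def
  by (metis add.right_inverse add_uminus_conv_diff diff_le_eq minus_diff_eq neg_le_iff_le diff_0 le_diff_eq add.commute)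

text \<open>
  The infimum over \<open>t \<ge> 0\<close> of \<open>p (x + t v) - t p v\<close> is the smallest value that sublinearity leaves possible at
  \<open>x\<close> once \<open>v\<close> is prescribed the value \<open>p v\<close>: it is the one-dimensional step of the Hahn--Banach theorem,
  phrased so that the result is again sublinear and the step can be repeated.
\<close>

lemma sublinear_linearize_direction:
  assumes p: "sublinear p"
  obtains q where "sublinear q" "\<And>x. q x \<le> p x" "q v = p v" "q (- v) = - p v"
proof -
  define q where "q x = (INF t\<in>{0::real..}. p (x + t *\<^sub>R v) - t * p v)" for x
  have add: "p (x + y) \<le> p x + p y" and scale: "a \<ge> 0 \<Longrightarrow> p (a *\<^sub>R x) = a * p x" for x y a
    using p unfolding sublinear_def by auto
  \<comment> \<open>This lower bound does not depend on \<open>t\<close>, so the infimum exists.\<close>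
  have lb: "- p (- x) \<le> p (x + t *\<^sub>R v) - t * p v" if "t \<ge> 0" for x t
    using add[of "x + t *\<^sub>R v" "- x"] scale[OF that, of v] by simp
  have bdd: "bdd_below ((\<lambda>t. p (x + t *\<^sub>R v) - t * p v) ` {0..})" for x
    using lb by (intro bdd_belowI2[where m = "- p (- x)"]) auto
  have le: "q x \<le> p (x + t *\<^sub>R v) - t * p v" if "t \<ge> 0" for x t
    unfolding q_def using that by (intro cINF_lower[OF bdd]) auto
  have ge: "r \<le> q x" if "\<And>t. t \<ge> 0 \<Longrightarrow> r \<le> p (x + t *\<^sub>R v) - t * p v" for r x
    unfolding q_def using that by (intro cINF_greatest) auto
  have qp: "q x \<le> p x" for x using le[of 0 x] by simp
  have qadd: "q (x + y) \<le> q x + q y" for x y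
  proof -
    have 1: "q (x + y) \<le> (p (x + a *\<^sub>R v) - a * p v) + (p (y + b *\<^sub>R v) - b * p v)"
      if "a \<ge> 0" "b \<ge> 0" for a b
      using le[of "a + b" "x + y"] add[of "x + a *\<^sub>R v" "y + b *\<^sub>R v"] that
      by (simp add: algebra_simps)
    have "q (x + y) - (p (x + a *\<^sub>R v) - a * p v) \<le> q y" if "a \<ge> 0" for a
      by (rule ge) (use 1[OF that] in force)
    then have "q (x + y) - q y \<le> q x" by (intro ge) force
    then show ?thesis by simp
  qed
  have qscale1: "q (a *\<^sub>R x) \<le> a * q x" if "a > 0" for a x
  proof -
    have "q (a *\<^sub>R x) / a \<le> p (x + t *\<^sub>R v) - t * p v" if "t \<ge> 0" for t
      using le[of "a * t" "a *\<^sub>R x"] scale[of a "x + t *\<^sub>R v"] that \<open>a > 0\<close>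
      by (simp add: field_simps scaleR_add_right)
    then have "q (a *\<^sub>R x) / a \<le> q x" by (rule ge)
    then show ?thesis using that by (simp add: field_simps)
  qed
  have q0: "q 0 = 0"
    using qp[of 0] sublinear_zero[OF p] lb[of _ 0] by (intro antisym ge) auto
  have qscale: "q (a *\<^sub>R x) = a * q x" if "a \<ge> 0" for a x
  proof (cases "a = 0")
    case False
    then show ?thesis
      using qscale1[of a x] qscale1[of "inverse a" "a *\<^sub>R x"] that by (force simp: field_simps)
  qed (simp add: q0)
  have sub: "sublinear q" unfolding sublinear_def using qadd qscale by blast
  have qv: "q v = p v"
  proof (rule antisym[OF qp], rule ge)
    show "p v \<le> p (v + t *\<^sub>R v) - t * p v" if "t \<ge> 0" for t
      using scale[of "1 + t" v] that by (simp add: algebra_simps)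
  qed
  have "q (- v) = - p v"
    using le[of 1 "- v"] sublinear_zero[OF p] sublinear_neg[OF sub, of "-v"] qv by auto
  with sub qp qv show thesis by (rule that)
qed

text \<open>
  After linearising along \<open>v\<close> and then along every basis vector, the remaining functional is additive on
  opposite vectors of a spanning set. The vectors with this property form a subspace, so it is linear.
\<close>

lemma sublinear_dominates_linear:
  fixes p :: "'v::euclidean_space \<Rightarrow> real"
  assumes "sublinear p"
  obtains f where "linear f" "\<And>x. f x \<le> p x" "f v = p v"
proof -
  have "\<exists>q. sublinear q \<and> (\<forall>x. q x \<le> p x) \<and> q v = p v \<and> (\<forall>b\<in>B. q b + q (- b) = 0)"
    if "finite B" for B
    using that
  proof (induction B)
    case empty
    show ?case using assms by auto
  next
    case (insert b B)
    then obtain q where q: "sublinear q" "\<And>x. q x \<le> p x" "q v = p v" "\<And>b. b \<in> B \<Longrightarrow> q b + q (- b) = 0"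
      by auto
    \<comment> \<open>Linearising again along \<open>v\<close> first keeps the value at \<open>v\<close> from dropping in the step for \<open>b\<close>.\<close>
    obtain q0 where q0: "sublinear q0" "\<And>x. q0 x \<le> q x" "q0 v = q v" "q0 (- v) = - q v"
      using sublinear_linearize_direction[OF q(1)] by blast
    obtain r where r: "sublinear r" "\<And>x. r x \<le> q0 x" "r b = q0 b" "r (- b) = - q0 b"
      using sublinear_linearize_direction[OF q0(1)] by blast
    have "r v = p v"
      using r(2)[of v] r(2)[of "-v"] sublinear_neg[OF r(1), of v] q0 q(3) by simp
    moreover have "r b' + r (- b') = 0" if "b' \<in> B" for b'
      using r(2)[of b'] r(2)[of "-b'"] sublinear_neg[OF r(1), of b'] q0(2)[of b'] q0(2)[of "-b'"]
        q(4)[OF that] by simp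
    moreover have "r x \<le> p x" for x
      using r(2)[of x] q0(2)[of x] q(2)[of x] by linarith
    ultimately show ?case
      using r q0(3) by (intro exI[of _ r]) auto
  qed
  from this[OF finite_Basis] obtain q where q: "sublinear q" "\<And>x. q x \<le> p x" "q v = p v"
    "\<And>b. b \<in> Basis \<Longrightarrow> q b + q (- b) = 0" by auto
  have add: "q (x + y) \<le> q x + q y" and scale: "a \<ge> 0 \<Longrightarrow> q (a *\<^sub>R x) = a * q x" for x y a
    using q(1) unfolding sublinear_def by auto
  have "subspace {x. q x + q (- x) = 0}"
    unfolding subspace_def
  proof (intro conjI ballI allI)
    show "0 \<in> {x. q x + q (- x) = 0}" using sublinear_zero[OF q(1)] by simp
    fix x y assume xy: "x \<in> {x. q x + q (- x) = 0}" "y \<in> {x. q x + q (- x) = 0}"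
    show "x + y \<in> {x. q x + q (- x) = 0}"
      using xy add[of x y] add[of "-x" "-y"] sublinear_neg[OF q(1), of "x + y"] by simp
  next
    fix a x assume x: "x \<in> {x. q x + q (- x) = 0}"
    show "a *\<^sub>R x \<in> {x. q x + q (- x) = 0}"
    proof (cases "a \<ge> 0")
      case True
      then show ?thesis using x scale[of a x] scale[of a "-x"] by (simp flip: distrib_left)
    next
      case False
      moreover have "q (- x) = - q x" using x by simp
      ultimately show ?thesis using scale[of "-a" x] scale[of "-a" "-x"] by simp
    qed
  qed
  then have "span Basis \<subseteq> {x. q x + q (- x) = 0}"
    by (rule span_minimal[rotated]) (use q(4) in auto)
  then have neg: "q (- x) = - q x" for x
    by (simp add: span_Basis subset_iff eq_neg_iff_add_eq_0 add.commute)
  have "linear q"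
  proof (rule linearI)
    show "q (x + y) = q x + q y" for x y
      using add[of x y] add[of "x + y" "-y"] neg[of y] by simp
    show "q (a *\<^sub>R x) = a *\<^sub>R q x" for a x
      using scale[of a x] scale[of "-a" x] neg[of "a *\<^sub>R x"] by (cases "a \<ge> 0") auto
  qed
  with q(2,3) show thesis using that by blast
qed

section \<open>Bounded Lipschitz cylinder functions\<close>

text \<open>
  The \<open>\<ell>\<^sup>1\<close>-distance replaces the Euclidean distance: it is equivalent for a fixed dimension and additive in the
  coordinates, which makes partial evaluation immediate. As in the function classes above, the Lipschitz
  bound forces independence of the coordinates from \<open>n\<close> on.
\<close>

definition BL :: "nat \<Rightarrow> ((nat \<Rightarrow> real) \<Rightarrow> real) set" where
  "BL n = {f. (\<exists>B. \<forall>x. \<bar>f x\<bar> \<le> B) \<and> (\<exists>C. \<forall>x y. \<bar>f x - f y\<bar> \<le> C * (\<Sum>i<n. \<bar>x i - y i\<bar>))}"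

lemma BL_I: "(\<And>x. \<bar>f x\<bar> \<le> B) \<Longrightarrow> (\<And>x y. \<bar>f x - f y\<bar> \<le> C * (\<Sum>i<n. \<bar>x i - y i\<bar>)) \<Longrightarrow> f \<in> BL n"
  unfolding BL_def by blast

lemma BL_E:
  assumes "f \<in> BL n"
  obtains B C where "B \<ge> 0" "C \<ge> 0" "\<And>x. \<bar>f x\<bar> \<le> B" "\<And>x y. \<bar>f x - f y\<bar> \<le> C * (\<Sum>i<n. \<bar>x i - y i\<bar>)"
proof -
  obtain B C where BC: "\<And>x. \<bar>f x\<bar> \<le> B" "\<And>x y. \<bar>f x - f y\<bar> \<le> C * (\<Sum>i<n. \<bar>x i - y i\<bar>)"
    using assms unfolding BL_def by blast
  have "B \<ge> 0" using BC(1)[of undefined] by linarith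
  moreover have "\<bar>f x - f y\<bar> \<le> max C 0 * (\<Sum>i<n. \<bar>x i - y i\<bar>)" for x y
    using BC(2)[of x y] mult_right_mono[of C "max C 0" "\<Sum>i<n. \<bar>x i - y i\<bar>"]
    by (simp add: sum_nonneg)
  ultimately show thesis using BC(1) that[of B "max C 0"] by auto
qed

lemma BL_const [intro, simp]: "(\<lambda>x. a) \<in> BL n"
  by (rule BL_I[where B = "\<bar>a\<bar>" and C = 0]) auto

lemma BL_add [intro]:
  assumes "f \<in> BL n" "g \<in> BL n"
  shows "(\<lambda>x. f x + g x) \<in> BL n"
proof -
  obtain B C where f: "\<And>x. \<bar>f x\<bar> \<le> B" "\<And>x y. \<bar>f x - f y\<bar> \<le> C * (\<Sum>i<n. \<bar>x i - y i\<bar>)"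
    using BL_E[OF assms(1)] by metis
  obtain B' C' where g: "\<And>x. \<bar>g x\<bar> \<le> B'" "\<And>x y. \<bar>g x - g y\<bar> \<le> C' * (\<Sum>i<n. \<bar>x i - y i\<bar>)"
    using BL_E[OF assms(2)] by metis
  show ?thesis
  proof (rule BL_I)
    show "\<bar>f x + g x\<bar> \<le> B + B'" for x using f(1)[of x] g(1)[of x] by linarith
    show "\<bar>f x + g x - (f y + g y)\<bar> \<le> (C + C') * (\<Sum>i<n. \<bar>x i - y i\<bar>)" for x y
      using f(2)[of x y] g(2)[of x y] unfolding distrib_right by linarith
  qed
qed

lemma BL_mult [intro]:
  assumes "f \<in> BL n" "g \<in> BL n"
  shows "(\<lambda>x. f x * g x) \<in> BL n"
proof -
  obtain B C where f: "B \<ge> 0" "C \<ge> 0" "\<And>x. \<bar>f x\<bar> \<le> B" "\<And>x y. \<bar>f x - f y\<bar> \<le> C * (\<Sum>i<n. \<bar>x i - y i\<bar>)"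
    using BL_E[OF assms(1)] by metis
  obtain B' C' where g: "B' \<ge> 0" "C' \<ge> 0" "\<And>x. \<bar>g x\<bar> \<le> B'" "\<And>x y. \<bar>g x - g y\<bar> \<le> C' * (\<Sum>i<n. \<bar>x i - y i\<bar>)"
    using BL_E[OF assms(2)] by metis
  show ?thesis
  proof (rule BL_I)
    show "\<bar>f x * g x\<bar> \<le> B * B'" for x
      unfolding abs_mult by (intro mult_mono f g) auto
    show "\<bar>f x * g x - f y * g y\<bar> \<le> (B * C' + B' * C) * (\<Sum>i<n. \<bar>x i - y i\<bar>)" for x y
    proof -
      have "f x * g x - f y * g y = f x * (g x - g y) + g y * (f x - f y)"
        by (simp add: algebra_simps)
      then have "\<bar>f x * g x - f y * g y\<bar> \<le> \<bar>f x\<bar> * \<bar>g x - g y\<bar> + \<bar>g y\<bar> * \<bar>f x - f y\<bar>"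
        by (metis abs_mult abs_triangle_ineq)
      also have "\<dots> \<le> B * (C' * (\<Sum>i<n. \<bar>x i - y i\<bar>)) + B' * (C * (\<Sum>i<n. \<bar>x i - y i\<bar>))"
        by (intro add_mono mult_mono f g) auto
      finally show ?thesis by (simp add: algebra_simps)
    qed
  qed
qed

lemma BL_max [intro]:
  assumes "f \<in> BL n" "g \<in> BL n"
  shows "(\<lambda>x. max (f x) (g x)) \<in> BL n"
proof -
  obtain B C where f: "B \<ge> 0" "C \<ge> 0" "\<And>x. \<bar>f x\<bar> \<le> B" "\<And>x y. \<bar>f x - f y\<bar> \<le> C * (\<Sum>i<n. \<bar>x i - y i\<bar>)"
    using BL_E[OF assms(1)] by metis
  obtain B' C' where g: "B' \<ge> 0" "C' \<ge> 0" "\<And>x. \<bar>g x\<bar> \<le> B'" "\<And>x y. \<bar>g x - g y\<bar> \<le> C' * (\<Sum>i<n. \<bar>x i - y i\<bar>)"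
    using BL_E[OF assms(2)] by metis
  show ?thesis
  proof (rule BL_I)
    show "\<bar>max (f x) (g x)\<bar> \<le> max B B'" for x using f(3)[of x] g(3)[of x] by linarith
    show "\<bar>max (f x) (g x) - max (f y) (g y)\<bar> \<le> (C + C') * (\<Sum>i<n. \<bar>x i - y i\<bar>)" for x y
    proof -
      have "0 \<le> C * (\<Sum>i<n. \<bar>x i - y i\<bar>)" "0 \<le> C' * (\<Sum>i<n. \<bar>x i - y i\<bar>)"
        using f(2) g(2) by (simp_all add: sum_nonneg)
      then show ?thesis
        using f(4)[of x y] g(4)[of x y] unfolding distrib_right by linarith
    qed
  qed
qed

lemma BL_minus [intro]: "f \<in> BL n \<Longrightarrow> (\<lambda>x. - f x) \<in> BL n"
  using BL_mult[OF BL_const[of "-1"], of f n] by simp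

lemma BL_diff [intro]: "f \<in> BL n \<Longrightarrow> g \<in> BL n \<Longrightarrow> (\<lambda>x. f x - g x) \<in> BL n"
  using BL_add[OF _ BL_minus, of f n g] by simp

lemma BL_min [intro]: "f \<in> BL n \<Longrightarrow> g \<in> BL n \<Longrightarrow> (\<lambda>x. min (f x) (g x)) \<in> BL n"
  using BL_minus[OF BL_max[OF BL_minus BL_minus, of f n g]] by (simp add: minus_max_eq_min)

lemma BL_power [intro]: "f \<in> BL n \<Longrightarrow> (\<lambda>x. f x ^ k) \<in> BL n"
  by (induction k) auto

lemma BL_sum [intro]: "(\<And>i. i \<in> I \<Longrightarrow> f i \<in> BL n) \<Longrightarrow> (\<lambda>x. \<Sum>i\<in>I. f i x) \<in> BL n"
  by (induction I rule: infinite_finite_induct) auto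

lemma BL_prod [intro]: "(\<And>i. i \<in> I \<Longrightarrow> f i \<in> BL n) \<Longrightarrow> (\<lambda>x. \<Prod>i\<in>I. f i x) \<in> BL n"
  by (induction I rule: infinite_finite_induct) auto

lemma BL_mono: assumes "f \<in> BL m" "m \<le> n" shows "f \<in> BL n"
proof -
  obtain B C where f: "B \<ge> 0" "C \<ge> 0" "\<And>x. \<bar>f x\<bar> \<le> B" "\<And>x y. \<bar>f x - f y\<bar> \<le> C * (\<Sum>i<m. \<bar>x i - y i\<bar>)"
    using BL_E[OF assms(1)] by metis
  show ?thesis
  proof (rule BL_I)
    show "\<bar>f x\<bar> \<le> B" for x by (rule f)
    show "\<bar>f x - f y\<bar> \<le> C * (\<Sum>i<n. \<bar>x i - y i\<bar>)" for x y
      by (rule order_trans[OF f(4)]) (use assms(2) f(2) in \<open>auto intro!: mult_left_mono sum_mono2\<close>)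
  qed
qed

lemma BL_cong: assumes "f \<in> BL n" "\<And>i. i < n \<Longrightarrow> x i = y i" shows "f x = f y"
proof -
  obtain C where "\<And>x y. \<bar>f x - f y\<bar> \<le> C * (\<Sum>i<n. \<bar>x i - y i\<bar>)" using BL_E[OF assms(1)] by metis
  from this[of x y] show ?thesis using assms(2) by simp
qed

lemma BL_update: "f \<in> BL i \<Longrightarrow> f (x(i := t)) = f x"
  by (rule BL_cong) auto

abbreviation clamp :: "real \<Rightarrow> real \<Rightarrow> real" where
  "clamp c t \<equiv> max (- c) (min t c)"

lemma BL_clamp [intro]:
  assumes "k < n" shows "(\<lambda>x. clamp c (x k)) \<in> BL n"
proof (rule BL_I)
  show "\<bar>clamp c (x k)\<bar> \<le> \<bar>c\<bar>" for x :: "nat \<Rightarrow> real" by linarith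
  show "\<bar>clamp c (x k) - clamp c (y k)\<bar> \<le> 1 * (\<Sum>i<n. \<bar>x i - y i\<bar>)" for x y :: "nat \<Rightarrow> real"
    using member_le_sum[of k "{..<n}" "\<lambda>i. \<bar>x i - y i\<bar>"] assms by auto
qed

lemma BL_abs [intro]: "f \<in> BL n \<Longrightarrow> (\<lambda>x. \<bar>f x\<bar>) \<in> BL n"
proof -
  assume "f \<in> BL n"
  then have "(\<lambda>x. max (f x) (- f x)) \<in> BL n" by (intro BL_max BL_minus)
  moreover have "(\<lambda>x. \<bar>f x\<bar>) = (\<lambda>x. max (f x) (- f x))" by auto
  ultimately show ?thesis by simp
qed

text \<open>
  Freezing the first \<open>i\<close> coordinates leaves a function of the \<open>i\<close>-th coordinate alone; it is regarded as a
  function of the whole sequence, so that the same functional applies to it.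
\<close>

lemma BL_section:
  assumes "f \<in> BL (Suc i)"
  shows "(\<lambda>z. f (x(i := z i))) \<in> BL (Suc i)"
proof -
  obtain B C where f: "B \<ge> 0" "C \<ge> 0" "\<And>x. \<bar>f x\<bar> \<le> B" "\<And>x y. \<bar>f x - f y\<bar> \<le> C * (\<Sum>i<Suc i. \<bar>x i - y i\<bar>)"
    using BL_E[OF assms(1)] by metis
  show ?thesis
  proof (rule BL_I)
    show "\<bar>f (x(i := z i))\<bar> \<le> B" for z by (rule f)
    show "\<bar>f (x(i := z i)) - f (x(i := y i))\<bar> \<le> C * (\<Sum>i<Suc i. \<bar>z i - y i\<bar>)" for z y
      by (rule order_trans[OF f(4)]) (use f(2) in \<open>auto intro!: mult_left_mono sum_nonneg\<close>)
  qed
qed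

section \<open>Sublinear expectations with the tower property\<close>

text \<open>
  The abstract law of an independent sequence: \<open>L_tower\<close> integrates the last coordinate out with all earlier
  ones frozen. The coordinate \<open>i\<close> of the inner variable \<open>z\<close> is the fresh one.
\<close>

locale iterated_expectation =
  fixes L :: "((nat \<Rightarrow> real) \<Rightarrow> real) \<Rightarrow> real"
  assumes L_mono: "f \<in> BL n \<Longrightarrow> g \<in> BL n \<Longrightarrow> (\<And>x. f x \<le> g x) \<Longrightarrow> L f \<le> L g"
    and L_const: "L (\<lambda>x. a) = a"
    and L_add: "f \<in> BL n \<Longrightarrow> g \<in> BL n \<Longrightarrow> L (\<lambda>x. f x + g x) \<le> L f + L g"
    and L_scale: "f \<in> BL n \<Longrightarrow> a \<ge> 0 \<Longrightarrow> L (\<lambda>x. a * f x) = a * L f"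
    and L_tower: "f \<in> BL (Suc i) \<Longrightarrow> L f = L (\<lambda>x. L (\<lambda>z. f (x(i := z i))))"
begin

lemma L_add_const:
  assumes "f \<in> BL n" shows "L (\<lambda>x. f x + a) = L f + a"
proof (rule antisym)
  show "L (\<lambda>x. f x + a) \<le> L f + a" using L_add[OF assms BL_const[of a]] by (simp add: L_const)
  show "L f + a \<le> L (\<lambda>x. f x + a)"
    using L_add[OF BL_add[OF assms BL_const[of a]] BL_const[of "- a"]] by (simp add: L_const)
qed

lemma L_nonneg: "f \<in> BL n \<Longrightarrow> (\<And>x. 0 \<le> f x) \<Longrightarrow> 0 \<le> L f"
  using L_mono[OF BL_const[of 0]] by (simp add: L_const)

lemma L_abs_diff:
  assumes "f \<in> BL n" "g \<in> BL n" "\<And>x. \<bar>f x - g x\<bar> \<le> d"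
  shows "\<bar>L f - L g\<bar> \<le> d"
proof -
  have "f x \<le> g x + d" "g x \<le> f x + d" for x using assms(3)[of x] by linarith+
  then have "L f \<le> L (\<lambda>x. g x + d)" "L g \<le> L (\<lambda>x. f x + d)"
    using assms(1,2) by (auto intro!: L_mono)
  then show ?thesis using L_add_const[OF assms(1)] L_add_const[OF assms(2)] by auto
qed

lemma BL_L_section:
  assumes "f \<in> BL (Suc i)"
  shows "(\<lambda>x. L (\<lambda>z. f (x(i := z i)))) \<in> BL i"
proof -
  obtain B C where f: "B \<ge> 0" "C \<ge> 0" "\<And>x. \<bar>f x\<bar> \<le> B" "\<And>x y. \<bar>f x - f y\<bar> \<le> C * (\<Sum>i<Suc i. \<bar>x i - y i\<bar>)"
    using BL_E[OF assms(1)] by metis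
  show ?thesis
  proof (rule BL_I)
    show "\<bar>L (\<lambda>z. f (x(i := z i)))\<bar> \<le> B" for x
      using L_abs_diff[OF BL_section[OF assms] BL_const[of 0], of x B] f(3) by (simp add: L_const)
    show "\<bar>L (\<lambda>z. f (x(i := z i))) - L (\<lambda>z. f (y(i := z i)))\<bar> \<le> C * (\<Sum>i<i. \<bar>x i - y i\<bar>)" for x y
    proof (rule L_abs_diff[OF BL_section[OF assms] BL_section[OF assms]])
      show "\<bar>f (x(i := z i)) - f (y(i := z i))\<bar> \<le> C * (\<Sum>i<i. \<bar>x i - y i\<bar>)" for z
        using f(4)[of "x(i := z i)" "y(i := z i)"] by simp
    qed
  qed
qed

text \<open>
  A conditional bound, valid for each frozen past \<open>x\<close>, holds in expectation. The two lemmas of this form replace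
  conditional expectations throughout.
\<close>

lemma L_tower_le:
  assumes "f \<in> BL (Suc i)" "g \<in> BL i" "\<And>x. L (\<lambda>z. f (x(i := z i))) \<le> g x"
  shows "L f \<le> L g"
  unfolding L_tower[OF assms(1)] using assms by (intro L_mono[OF BL_L_section])

lemma L_tower_ge:
  assumes "f \<in> BL (Suc i)" "g \<in> BL i" "\<And>x. g x \<le> L (\<lambda>z. f (x(i := z i)))"
  shows "L g \<le> L f"
  unfolding L_tower[OF assms(1)] using assms by (intro L_mono[OF _ BL_L_section])

end

section \<open>A one-sided maximal inequality\<close>

context
  fixes \<psi> :: "nat \<Rightarrow> real \<Rightarrow> real" and m :: nat and \<epsilon> :: real
begin

definition block_sum :: "nat \<Rightarrow> (nat \<Rightarrow> real) \<Rightarrow> real" where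
  "block_sum j x = (\<Sum>k=m..<m + j. \<psi> k (x k))"

text \<open>
  Equal to one up to \<open>\<epsilon> / 2\<close> and to zero from \<open>\<epsilon>\<close> on.
\<close>

definition cutoff :: "real \<Rightarrow> real" where
  "cutoff r = max 0 (min 1 (2 - 2 * r / \<epsilon>))"

text \<open>
  A Lipschitz substitute for the indicator that no partial sum up to \<open>j\<close> has become large. A product rather
  than a function of the running maximum: it drops at step \<open>j\<close> only if the current sum exceeds \<open>\<epsilon> / 2\<close>.
\<close>

definition weight :: "nat \<Rightarrow> (nat \<Rightarrow> real) \<Rightarrow> real" where
  "weight j x = (\<Prod>i\<le>j. cutoff (block_sum i x))"

text \<open>
  The martingale transform of the sum by the weights: each increment is multiplied by a weight that depends
  on the past only.
\<close>

definition stopped_sum :: "nat \<Rightarrow> (nat \<Rightarrow> real) \<Rightarrow> real" where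
  "stopped_sum j x = (\<Sum>i<j. weight i x * \<psi> (m + i) (x (m + i)))"

lemma weight_bounds: "0 \<le> weight j x" "weight j x \<le> 1"
  unfolding weight_def cutoff_def by (auto intro!: prod_nonneg prod_le_1)

text \<open>
  Summation by parts: the stopped sum is a weighted mean of the current sum, with the current weight, and of
  the sums at the times when the weight dropped, all of which are at least \<open>\<epsilon> / 2\<close>.
\<close>

lemma stopped_sum_ge:
  assumes "\<epsilon> > 0"
  shows "weight j x * block_sum j x + \<epsilon> / 2 * (1 - weight j x) \<le> stopped_sum j x"
proof (induction j)
  case 0
  show ?case by (simp add: weight_def stopped_sum_def block_sum_def cutoff_def)
next
  case (Suc j)
  let ?g = "cutoff (block_sum (Suc j) x)" and ?S = "block_sum (Suc j) x"
  have w: "weight (Suc j) x = weight j x * ?g" by (simp add: weight_def)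
  have S: "?S = block_sum j x + \<psi> (m + j) (x (m + j))" by (simp add: block_sum_def)
  have W: "stopped_sum (Suc j) x = stopped_sum j x + weight j x * \<psi> (m + j) (x (m + j))"
    by (simp add: stopped_sum_def)
  have "0 \<le> (1 - ?g) * (?S - \<epsilon> / 2)"
  proof (cases "?S \<le> \<epsilon> / 2")
    case True
    then have "?g = 1" using assms by (simp add: cutoff_def field_simps)
    then show ?thesis by simp
  next
    case False
    then show ?thesis by (intro mult_nonneg_nonneg) (auto simp: cutoff_def)
  qed
  then have "0 \<le> weight j x * ((1 - ?g) * (?S - \<epsilon> / 2))"
    by (rule mult_nonneg_nonneg[OF weight_bounds(1)])
  with Suc.IH show ?case unfolding w W by (simp add: S algebra_simps)
qed

lemma stopped_sum_ge_of_exceeds: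
  assumes "\<epsilon> > 0" "i \<le> j" "\<epsilon> \<le> block_sum i x"
  shows "\<epsilon> / 2 \<le> stopped_sum j x"
proof -
  have "cutoff (block_sum i x) = 0" using assms by (simp add: cutoff_def field_simps)
  then have "weight j x = 0" unfolding weight_def using assms by (intro prod_zero) auto
  then show ?thesis using stopped_sum_ge[OF assms(1), of j x] by simp
qed

lemma BL_block_sum:
  assumes "\<And>k. (\<lambda>x. \<psi> k (x k)) \<in> BL (Suc k)"
  shows "block_sum j \<in> BL (m + j)"
  unfolding block_sum_def[abs_def] by (intro BL_sum BL_mono[OF assms]) auto

lemma BL_weight:
  assumes "\<And>k. (\<lambda>x. \<psi> k (x k)) \<in> BL (Suc k)"
  shows "weight j \<in> BL (m + j)"
proof -
  have "(\<lambda>x. cutoff (block_sum i x)) \<in> BL (m + j)" if "i \<le> j" for i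
  proof -
    have "block_sum i \<in> BL (m + j)" by (rule BL_mono[OF BL_block_sum[OF assms]]) (use that in simp)
    from BL_mult[OF BL_const[of "2 / \<epsilon>"] this] show ?thesis
      unfolding cutoff_def by (intro BL_max BL_min BL_diff BL_const) simp
  qed
  then show ?thesis unfolding weight_def[abs_def] by (intro BL_prod) auto
qed

lemma BL_stopped_sum:
  assumes "\<And>k. (\<lambda>x. \<psi> k (x k)) \<in> BL (Suc k)"
  shows "stopped_sum j \<in> BL (m + j)"
  unfolding stopped_sum_def[abs_def]
  by (intro BL_sum BL_mult BL_mono[OF BL_weight[OF assms]] BL_mono[OF assms]) auto

end

context iterated_expectation
begin

text \<open>
  For real \<open>w\<close> and \<open>z\<close>, \<open>((w + z)\<^sup>+)\<^sup>2 \<le> (w\<^sup>+)\<^sup>2 + 2 w\<^sup>+ z + z\<^sup>2\<close>. The mixed term carries the nonnegative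
  factor \<open>w\<^sup>+\<close>, so a nonpositive upper mean of the increment makes its contribution nonpositive. With the square
  of \<open>w\<close> itself the factor could be negative, and the lower means would enter.
\<close>

lemma L_stopped_sum_sq:
  assumes BL: "\<And>k. (\<lambda>x. \<psi> k (x k)) \<in> BL (Suc k)" and neg: "\<And>k. L (\<lambda>x. \<psi> k (x k)) \<le> 0"
  shows "L (\<lambda>x. (max 0 (stopped_sum \<psi> m \<epsilon> j x))\<^sup>2) \<le> (\<Sum>k=m..<m + j. L (\<lambda>x. (\<psi> k (x k))\<^sup>2))"
proof (induction j)
  case 0
  show ?case by (simp add: stopped_sum_def L_const)
next
  case (Suc j)
  let ?k = "m + j"
  let ?z = "\<lambda>x. \<psi> ?k (x ?k)"
  have z: "?z \<in> BL (Suc ?k)" by (rule BL)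
  have z2: "(\<lambda>x. (?z x)\<^sup>2) \<in> BL (Suc ?k)" using z by (rule BL_power)
  have W: "(\<lambda>x. (max 0 (stopped_sum \<psi> m \<epsilon> j x))\<^sup>2) \<in> BL ?k"
    by (intro BL_power BL_max BL_const BL_stopped_sum BL)
  have W': "(\<lambda>x. (max 0 (stopped_sum \<psi> m \<epsilon> (Suc j) x))\<^sup>2) \<in> BL (Suc ?k)"
    using BL_stopped_sum[OF BL, where j = "Suc j"] by (auto intro!: BL_power BL_max)
  have "L (\<lambda>x. (max 0 (stopped_sum \<psi> m \<epsilon> (Suc j) x))\<^sup>2) \<le> L (\<lambda>x. (max 0 (stopped_sum \<psi> m \<epsilon> j x))\<^sup>2 + L (\<lambda>x. (?z x)\<^sup>2))"
  proof (rule L_tower_le[OF W'])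
    show "(\<lambda>x. (max 0 (stopped_sum \<psi> m \<epsilon> j x))\<^sup>2 + L (\<lambda>x. (?z x)\<^sup>2)) \<in> BL ?k" using W by auto
    fix x :: "nat \<Rightarrow> real"
    define w g where "w = stopped_sum \<psi> m \<epsilon> j x" and "g = weight \<psi> m \<epsilon> j x"
    have g: "0 \<le> g" "g \<le> 1" unfolding g_def by (rule weight_bounds)+
    have eq: "stopped_sum \<psi> m \<epsilon> (Suc j) (x(?k := t)) = w + g * \<psi> ?k t" for t
      using BL_update[where x = x and t = t, OF BL_weight[OF BL, where j = j]]
        BL_update[where x = x and t = t, OF BL_stopped_sum[OF BL, where j = j]]
      unfolding w_def g_def by (simp add: stopped_sum_def)
    define r where "r = 2 * max 0 w * g"
    have r: "r \<ge> 0" unfolding r_def using g by simp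
    have pw: "(max 0 (w + g * v))\<^sup>2 \<le> r * v + (max 0 w)\<^sup>2 + v\<^sup>2" for v
    proof -
      have gv: "(g * v)\<^sup>2 \<le> v\<^sup>2"
        using g by (simp add: power_mult_distrib mult_left_le_one_le power_le_one)
      show ?thesis
      proof (cases "w \<ge> 0")
        case True
        have "(max 0 (w + g * v))\<^sup>2 \<le> (w + g * v)\<^sup>2" by (simp add: max_def)
        also have "\<dots> = r * v + w\<^sup>2 + (g * v)\<^sup>2" using True unfolding r_def
          by (simp add: power2_eq_square algebra_simps)
        finally show ?thesis using gv True by simp
      next
        case False
        have "max 0 (w + g * v) \<le> \<bar>g * v\<bar>" using False by linarith
        then have "(max 0 (w + g * v))\<^sup>2 \<le> (g * v)\<^sup>2"
          by (metis max.cobounded1 power2_abs power_mono)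
        then show ?thesis using gv False unfolding r_def by simp
      qed
    qed
    have "L (\<lambda>z. (max 0 (stopped_sum \<psi> m \<epsilon> (Suc j) (x(?k := z ?k))))\<^sup>2)
        \<le> L (\<lambda>z. (r * ?z z + (max 0 w)\<^sup>2) + (?z z)\<^sup>2)"
    proof (rule L_mono[OF BL_section[OF W']])
      show "(\<lambda>z. (r * ?z z + (max 0 w)\<^sup>2) + (?z z)\<^sup>2) \<in> BL (Suc ?k)"
        using z z2 by (intro BL_add BL_mult BL_const)
    qed (use pw eq in auto)
    also have "\<dots> \<le> L (\<lambda>z. r * ?z z + (max 0 w)\<^sup>2) + L (\<lambda>z. (?z z)\<^sup>2)"
      by (rule L_add[OF _ z2]) (use z in \<open>intro BL_add BL_mult BL_const\<close>)
    also have "L (\<lambda>z. r * ?z z + (max 0 w)\<^sup>2) = r * L ?z + (max 0 w)\<^sup>2"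
      using L_add_const[OF BL_mult[OF BL_const z], of r "(max 0 w)\<^sup>2"] L_scale[OF z r] by simp
    finally show "L (\<lambda>z. (max 0 (stopped_sum \<psi> m \<epsilon> (Suc j) (x(?k := z ?k))))\<^sup>2)
        \<le> (max 0 (stopped_sum \<psi> m \<epsilon> j x))\<^sup>2 + L (\<lambda>x. (?z x)\<^sup>2)"
      using mult_nonneg_nonpos[OF r neg[of ?k]] unfolding w_def by linarith
  qed
  also have "\<dots> = L (\<lambda>x. (max 0 (stopped_sum \<psi> m \<epsilon> j x))\<^sup>2) + L (\<lambda>x. (?z x)\<^sup>2)" by (rule L_add_const[OF W])
  finally show ?case using Suc.IH by simp
qed

text \<open>
  The bound is carried by a cylinder function above the indicator of the event, because this is what
  bounds a capacity.
\<close>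

lemma maximal_inequality:
  assumes BL: "\<And>k. (\<lambda>x. \<psi> k (x k)) \<in> BL (Suc k)" and neg: "\<And>k. L (\<lambda>x. \<psi> k (x k)) \<le> 0"
    and "\<epsilon> > 0"
  obtains f where "f \<in> BL (m + j)" "\<And>x. 0 \<le> f x"
    "\<And>x i. i \<le> j \<Longrightarrow> \<epsilon> \<le> (\<Sum>k=m..<m + i. \<psi> k (x k)) \<Longrightarrow> 1 \<le> f x"
    "L f \<le> 4 / \<epsilon>\<^sup>2 * (\<Sum>k=m..<m + j. L (\<lambda>x. (\<psi> k (x k))\<^sup>2))"
proof
  define h where "h x = (max 0 (stopped_sum \<psi> m \<epsilon> j x))\<^sup>2" for x
  have h: "h \<in> BL (m + j)" unfolding h_def[abs_def]
    by (intro BL_power BL_max BL_const BL_stopped_sum BL)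
  show "(\<lambda>x. 4 / \<epsilon>\<^sup>2 * h x) \<in> BL (m + j)" by (intro BL_mult BL_const h)
  show "0 \<le> 4 / \<epsilon>\<^sup>2 * h x" for x by (simp add: h_def)
  show "1 \<le> 4 / \<epsilon>\<^sup>2 * h x" if "i \<le> j" "\<epsilon> \<le> (\<Sum>k=m..<m + i. \<psi> k (x k))" for x i
  proof -
    have "\<epsilon> / 2 \<le> stopped_sum \<psi> m \<epsilon> j x"
      using stopped_sum_ge_of_exceeds[OF \<open>\<epsilon> > 0\<close> that(1)] that(2) by (simp add: block_sum_def)
    then have "(\<epsilon> / 2)\<^sup>2 \<le> h x" unfolding h_def using \<open>\<epsilon> > 0\<close> by (intro power_mono) auto
    then show ?thesis using \<open>\<epsilon> > 0\<close> by (simp add: field_simps power2_eq_square)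
  qed
  show "L (\<lambda>x. 4 / \<epsilon>\<^sup>2 * h x) \<le> 4 / \<epsilon>\<^sup>2 * (\<Sum>k=m..<m + j. L (\<lambda>x. (\<psi> k (x k))\<^sup>2))"
    using L_stopped_sum_sq[of \<psi> m \<epsilon> j, OF BL neg]
    by (subst L_scale[OF h]) (auto simp: h_def[abs_def] intro!: divide_right_mono)
qed

end

section \<open>Centred variances and block convergence\<close>

text \<open>
  Chaining block ends gives a bound by the tail of \<open>r\<close> for the distance to the start of a block.
\<close>

lemma convergent_of_block_bounds:
  fixes P :: "nat \<Rightarrow> real"
  assumes n: "strict_mono n" and r: "summable r" "\<And>j. 0 \<le> r j"
    and block: "\<And>j i. j \<ge> J \<Longrightarrow> i \<le> n (Suc j) - n j \<Longrightarrow> \<bar>P (n j + i) - P (n j)\<bar> \<le> r j"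
  shows "convergent P"
proof -
  have reach: "\<bar>P i - P (n j)\<bar> \<le> (\<Sum>k=j..<j + d. r k)" if "j \<ge> J" "n j \<le> i" "i \<le> n (j + d)" for i j d
    using that(2,3)
  proof (induction d arbitrary: i)
    case 0
    then show ?case by simp
  next
    case (Suc d)
    have nd: "n j \<le> n (j + d)" using n by (simp add: strict_mono_less_eq)
    show ?case
    proof (cases "i \<le> n (j + d)")
      case True
      then show ?thesis using Suc.IH[of i] Suc.prems r(2)[of "j + d"] by simp
    next
      case False
      then have "\<bar>P i - P (n (j + d))\<bar> \<le> r (j + d)"
        using block[of "j + d" "i - n (j + d)"] Suc.prems \<open>j \<ge> J\<close> by simp
      then show ?thesis using Suc.IH[of "n (j + d)"] nd by simp
    qed
  qed
  have "Cauchy P"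
  proof (rule CauchyI)
    fix e :: real assume "0 < e"
    then obtain N where N: "\<And>m n. m \<ge> N \<Longrightarrow> norm (\<Sum>k=m..<n. r k) < e / 2"
      using r(1)[unfolded summable_Cauchy, rule_format, of "e / 2"] by auto
    define j where "j = max N J"
    have near: "\<bar>P i - P (n j)\<bar> < e / 2" if "n j \<le> i" for i
    proof -
      have "i \<le> n i" by (rule seq_suble[OF n])
      also have "\<dots> \<le> n (j + i)" using n by (simp add: strict_mono_less_eq)
      finally have "\<bar>P i - P (n j)\<bar> \<le> (\<Sum>k=j..<j + i. r k)"
        using reach[of j i i] that by (simp add: j_def)
      also have "\<dots> < e / 2" using N[of j "j + i"] by (auto simp: j_def)
      finally show ?thesis .
    qed
    show "\<exists>M. \<forall>m\<ge>M. \<forall>n\<ge>M. norm (P m - P n) < e"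
    proof (intro exI[of _ "n j"] allI impI)
      fix a b assume "n j \<le> a" "n j \<le> b"
      then show "norm (P a - P b) < e" using near[of a] near[of b] unfolding real_norm_def by linarith
    qed
  qed
  then show ?thesis by (rule Cauchy_convergent)
qed

text \<open>
  The rate \<open>8\<^sup>-\<^sup>j\<close> leaves a summable bound after division by the square of the oscillation \<open>2\<^sup>-\<^sup>j\<close> that is
  tolerated in block \<open>j\<close>.
\<close>

lemma summable_blocks:
  fixes a :: "nat \<Rightarrow> real"
  assumes "summable a"
  obtains n where "strict_mono n" "\<And>j l. (\<Sum>k=n j..<n j + l. a k) \<le> (1 / 8) ^ j"
proof -
  have "\<exists>N. \<forall>m\<ge>N. \<forall>l. (\<Sum>k=m..<l. a k) \<le> (1 / 8) ^ j" for j
  proof -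
    obtain N where "\<forall>m\<ge>N. \<forall>l. norm (\<Sum>k=m..<l. a k) < (1 / 8) ^ j"
      using assms[unfolded summable_Cauchy, rule_format, of "(1 / 8) ^ j"] by auto
    then show ?thesis by (intro exI[of _ N] allI impI) (smt (verit) real_norm_def)
  qed
  then obtain N where N: "\<And>j m l. m \<ge> N j \<Longrightarrow> (\<Sum>k=m..<l. a k) \<le> (1 / 8) ^ j" by metis
  have "\<exists>n. \<forall>j. N j \<le> n j \<and> n j < n (Suc j)"
  proof (rule dependent_nat_choice)
    show "\<exists>x. N 0 \<le> x" by blast
    show "\<exists>y. N (Suc j) \<le> y \<and> x < y" for x j by (intro exI[of _ "max (N (Suc j)) (Suc x)"]) auto
  qed
  then obtain n where "\<And>j. N j \<le> n j" "\<And>j. n j < n (Suc j)" by blast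
  then show thesis using that[of n] N by (simp add: strict_mono_Suc_iff)
qed

context iterated_expectation
begin

lemma L_clamp_bounds:
  assumes "c > 0"
  shows "L (\<lambda>x. clamp c (x k)) \<le> c" "L (\<lambda>x. - clamp c (x k)) \<le> c"
  using L_mono[OF BL_clamp[OF lessI] BL_const, of c k c]
    L_mono[OF BL_minus[OF BL_clamp[OF lessI]] BL_const, of c k c] assms
  by (simp_all add: L_const minus_le_iff)

lemma L_shift_sq_le:
  assumes f: "f \<in> BL n"
  shows "L (\<lambda>x. (f x + d)\<^sup>2) \<le> 2 * L (\<lambda>x. (f x)\<^sup>2) + 2 * d\<^sup>2"
proof -
  have f2: "(\<lambda>x. (f x)\<^sup>2) \<in> BL n" using f by (rule BL_power)
  have "L (\<lambda>x. (f x + d)\<^sup>2) \<le> L (\<lambda>x. 2 * (f x)\<^sup>2 + 2 * d\<^sup>2)"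
  proof (rule L_mono)
    show "(\<lambda>x. (f x + d)\<^sup>2) \<in> BL n" by (intro BL_power BL_add BL_const f)
    show "(\<lambda>x. 2 * (f x)\<^sup>2 + 2 * d\<^sup>2) \<in> BL n" by (intro BL_mult BL_add BL_const f2)
    show "(f x + d)\<^sup>2 \<le> 2 * (f x)\<^sup>2 + 2 * d\<^sup>2" for x
      using zero_le_power2[of "f x - d"] by (simp add: power2_eq_square algebra_simps)
  qed
  also have "\<dots> = 2 * L (\<lambda>x. (f x)\<^sup>2) + 2 * d\<^sup>2"
    using L_add_const[OF BL_mult[OF BL_const f2], of 2 "2 * d\<^sup>2"] L_scale[OF f2, of 2] by simp
  finally show ?thesis .
qed

text \<open>
  The two centrings differ by \<open>\<mu> k + \<nu> k\<close>, which is nonnegative, at most \<open>2 c\<close> and summable, hence square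
  summable. So finiteness of one of the variance series implies that of the other.
\<close>

lemma summable_variances:
  fixes c :: real
  defines "\<mu> \<equiv> \<lambda>k. L (\<lambda>x. clamp c (x k))" and "\<nu> \<equiv> \<lambda>k. L (\<lambda>x. - clamp c (x k))"
  assumes "c > 0" and sum: "summable \<mu>" "summable \<nu>"
    and var: "summable (\<lambda>k. L (\<lambda>x. (clamp c (x k) - \<mu> k)\<^sup>2)) \<or> summable (\<lambda>k. L (\<lambda>x. (clamp c (x k) + \<nu> k)\<^sup>2))"
  shows "summable (\<lambda>k. L (\<lambda>x. (clamp c (x k) - \<mu> k)\<^sup>2))" "summable (\<lambda>k. L (\<lambda>x. (clamp c (x k) + \<nu> k)\<^sup>2))"
proof -
  have y: "(\<lambda>x. clamp c (x k)) \<in> BL (Suc k)" for k by (rule BL_clamp) simp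
  define \<delta> where "\<delta> k = \<mu> k + \<nu> k" for k
  have \<delta>: "0 \<le> \<delta> k" "\<delta> k \<le> 2 * c" for k
    using L_clamp_bounds[OF \<open>c > 0\<close>, of k] L_add[OF y BL_minus[OF y], of k]
    by (auto simp: \<delta>_def \<mu>_def \<nu>_def L_const)
  have \<delta>2: "(\<delta> k)\<^sup>2 \<le> 2 * c * \<delta> k" for k
    using mult_right_mono[OF \<delta>(2) \<delta>(1)] by (simp add: power2_eq_square)
  have \<delta>sum: "summable \<delta>" unfolding \<delta>_def by (intro summable_add sum)
  have comp: "summable (\<lambda>k. L (\<lambda>x. (clamp c (x k) + b k)\<^sup>2))"
    if "summable (\<lambda>k. L (\<lambda>x. (clamp c (x k) + a k)\<^sup>2))" and "\<And>k. \<bar>b k - a k\<bar> = \<delta> k" for a b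
  proof (rule summable_comparison_test'[where N = 0])
    show "summable (\<lambda>k. 2 * L (\<lambda>x. (clamp c (x k) + a k)\<^sup>2) + 2 * (2 * c * \<delta> k))"
      by (intro summable_add summable_mult that \<delta>sum)
    fix k :: nat
    have f: "(\<lambda>x. clamp c (x k) + d) \<in> BL (Suc k)" for d by (intro BL_add y BL_const)
    have "(b k - a k)\<^sup>2 = (\<delta> k)\<^sup>2" using that(2)[of k] by (metis power2_abs)
    then have "L (\<lambda>x. (clamp c (x k) + b k)\<^sup>2) \<le> 2 * L (\<lambda>x. (clamp c (x k) + a k)\<^sup>2) + 2 * (2 * c * \<delta> k)"
      using L_shift_sq_le[OF f[of "a k"], of "b k - a k"] \<delta>2[of k] by simp
    moreover have "0 \<le> L (\<lambda>x. (clamp c (x k) + b k)\<^sup>2)"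
      by (rule L_nonneg[OF BL_power[OF f]]) simp
    ultimately show "norm (L (\<lambda>x. (clamp c (x k) + b k)\<^sup>2)) \<le> 2 * L (\<lambda>x. (clamp c (x k) + a k)\<^sup>2) + 2 * (2 * c * \<delta> k)"
      by simp
  qed
  have d: "\<bar>- \<mu> k - \<nu> k\<bar> = \<delta> k" "\<bar>\<nu> k - - \<mu> k\<bar> = \<delta> k" for k
    using \<delta>(1)[of k] unfolding \<delta>_def by linarith+
  show "summable (\<lambda>k. L (\<lambda>x. (clamp c (x k) - \<mu> k)\<^sup>2))"
    using var comp[of \<nu> "\<lambda>k. - \<mu> k", OF _ d(1)] by auto
  show "summable (\<lambda>k. L (\<lambda>x. (clamp c (x k) + \<nu> k)\<^sup>2))"
    using var comp[of "\<lambda>k. - \<mu> k" \<nu>, OF _ d(2)] by auto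
qed

end

section \<open>Summability of the probabilities of large terms\<close>

text \<open>
  A Lipschitz function between the indicators of \<open>\<bar>t\<bar> > c\<close> and of \<open>\<bar>t\<bar> > c / 2\<close>.
\<close>

definition excess :: "real \<Rightarrow> real \<Rightarrow> real" where
  "excess c t = max 0 (2 / c * \<bar>clamp c t\<bar> - 1)"

lemma excess_props:
  assumes "c > 0"
  shows "0 \<le> excess c t" "excess c t \<le> 1" "c < \<bar>t\<bar> \<Longrightarrow> excess c t = 1" "\<bar>t\<bar> \<le> c / 2 \<Longrightarrow> excess c t = 0"
proof -
  have "\<bar>clamp c t\<bar> \<le> c" using assms by linarith
  then show "excess c t \<le> 1" using assms by (simp add: excess_def field_simps)
  show "excess c t = 1" if "c < \<bar>t\<bar>"
  proof -
    have "\<bar>clamp c t\<bar> = c" using that assms by linarith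
    then show ?thesis using assms by (simp add: excess_def)
  qed
  show "excess c t = 0" if "\<bar>t\<bar> \<le> c / 2"
  proof -
    have "\<bar>clamp c t\<bar> \<le> c / 2" using that assms by linarith
    then show ?thesis using assms by (simp add: excess_def field_simps)
  qed
qed (simp add: excess_def)

lemma BL_excess: "(\<lambda>x. excess c (x k)) \<in> BL (Suc k)"
  unfolding excess_def by (intro BL_max BL_const BL_diff BL_mult BL_abs BL_clamp) simp

context iterated_expectation
begin

text \<open>
  The lower expectation \<open>f \<mapsto> - L (- f)\<close> is multiplicative on nonnegative functions of different coordinates:
  the product over the past is a nonnegative constant when the last coordinate is integrated out.
\<close>

lemma L_neg_prod:
  assumes BL: "\<And>k. (\<lambda>x. \<phi> k (x k)) \<in> BL (Suc k)" and nonneg: "\<And>k t. 0 \<le> \<phi> k t"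
  shows "L (\<lambda>x. - (\<Prod>k=m..<m + j. \<phi> k (x k))) = - (\<Prod>k=m..<m + j. - L (\<lambda>x. - \<phi> k (x k)))"
proof (induction j)
  case 0
  show ?case by (simp add: L_const)
next
  case (Suc j)
  define P where "P x = (\<Prod>k=m..<m + j. \<phi> k (x k))" for x
  have P: "P \<in> BL (m + j)" unfolding P_def[abs_def]
    by (intro BL_prod BL_mono[OF BL]) auto
  define r where "r = - L (\<lambda>x. - \<phi> (m + j) (x (m + j)))"
  have r: "0 \<le> r" unfolding r_def
    using L_mono[OF BL_minus[OF BL] BL_const[of 0], of "m + j"] nonneg by (simp add: L_const)
  have P': "(\<lambda>x. - (P x * \<phi> (m + j) (x (m + j)))) \<in> BL (Suc (m + j))"
    by (intro BL_minus BL_mult BL_mono[OF P] BL) simp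
  have "L (\<lambda>x. - (P x * \<phi> (m + j) (x (m + j))))
      = L (\<lambda>x. L (\<lambda>z. P x * - \<phi> (m + j) (z (m + j))))"
    by (subst L_tower[OF P']) (simp add: BL_update[OF P])
  also have "\<dots> = L (\<lambda>x. r * - P x)"
    by (subst L_scale[OF BL_minus[OF BL]]) (auto simp: r_def P_def mult.commute intro!: prod_nonneg nonneg)
  also have "\<dots> = r * L (\<lambda>x. - P x)" by (rule L_scale[OF BL_minus[OF P] r])
  finally show ?case using Suc.IH unfolding P_def r_def by simp
qed

text \<open>
  The hypothesis says that the upper probability of a large term in any block from \<open>m\<close> on is at most one half, so
  the product of the lower probabilities of small terms, smoothed to \<open>1 - a k\<close> with \<open>a k\<close> the upper expectation
  of the excess, is at least one half. As \<open>1 - a \<le> exp (- a)\<close>, this bounds the sum of the \<open>a k\<close> by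
  \<open>ln 2\<close>.
\<close>

lemma summable_excess:
  assumes "c > 0" and conc: "\<And>j. L (\<lambda>x. 1 - (\<Prod>k=m..<m + j. 1 - excess c (x k))) \<le> 1 / 2"
  shows "summable (\<lambda>k. L (\<lambda>x. excess c (x k)))"
proof -
  define a where "a k = L (\<lambda>x. excess c (x k))" for k
  note e = excess_props[OF \<open>c > 0\<close>]
  have a: "0 \<le> a k" "a k \<le> 1" for k
    unfolding a_def using L_nonneg[OF BL_excess, of c k] L_mono[OF BL_excess BL_const, of c k 1] e
    by (simp_all add: L_const)
  have BL: "(\<lambda>x. 1 - excess c (x k)) \<in> BL (Suc k)" for k by (intro BL_diff BL_const BL_excess)
  have "(\<Sum>k=m..<m + j. a k) \<le> ln 2" for j
  proof -
    have P: "(\<lambda>x. \<Prod>k=m..<m + j. 1 - excess c (x k)) \<in> BL (m + j)"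
      by (intro BL_prod BL_mono[OF BL]) auto
    have "L (\<lambda>x. 1 - (\<Prod>k=m..<m + j. 1 - excess c (x k)))
        = 1 - (\<Prod>k=m..<m + j. - L (\<lambda>x. - (1 - excess c (x k))))"
      using L_add_const[OF BL_minus[OF P], of 1] L_neg_prod[of "\<lambda>k t. 1 - excess c t" m j, OF BL] e
      by simp
    moreover have "- L (\<lambda>x. - (1 - excess c (x k))) = 1 - a k" for k
      using L_add_const[OF BL_excess, of c k "-1"] by (simp add: a_def)
    ultimately have "1 / 2 \<le> (\<Prod>k=m..<m + j. 1 - a k)" using conc[of j] by simp
    also have "\<dots> \<le> (\<Prod>k=m..<m + j. exp (- a k))"
    proof (rule prod_mono)
      show "0 \<le> 1 - a k \<and> 1 - a k \<le> exp (- a k)" for k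
        using a(2)[of k] exp_ge_add_one_self[of "- a k"] by simp
    qed
    also have "\<dots> = exp (- (\<Sum>k=m..<m + j. a k))" by (simp add: exp_sum flip: sum_negf)
    finally have "ln (1 / 2) \<le> - (\<Sum>k=m..<m + j. a k)" using ln_mono[of "1 / 2" "exp (- (\<Sum>k=m..<m + j. a k))"] by simp
    then show ?thesis by (simp add: ln_div)
  qed
  then have "summable (\<lambda>k. a (k + m))"
    by (intro summableI_nonneg_bounded[where x = "ln 2"])
       (use a in \<open>auto simp: sum.atLeastLessThan_shift_0[of a m] lessThan_atLeast0 add.commute comp_def\<close>)
  then have "summable a" by (simp only: summable_iff_shift)
  then show ?thesis unfolding a_def[abs_def] .
qed

end

section \<open>Moments of dominated linear functionals and concentration\<close>

lemma quartic_shift: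
  fixes w b :: real
  shows "a0 + a1 * (w + b) + a2 * (w + b) ^ 2 + a3 * (w + b) ^ 3 + a4 * (w + b) ^ 4
    = (a1 + 2 * a2 * w + 3 * a3 * w ^ 2 + 4 * a4 * w ^ 3) * b + (a2 + 3 * a3 * w + 6 * a4 * w ^ 2) * b ^ 2
      + (a3 + 4 * a4 * w) * b ^ 3 + a4 * b ^ 4 + (a0 + a1 * w + a2 * w ^ 2 + a3 * w ^ 3 + a4 * w ^ 4)"
  by algebra

context iterated_expectation
begin

text \<open>
  The numbers \<open>m1\<close> to \<open>m4\<close> are the moments under a linear functional below \<open>L\<close> that touches it at a prescribed
  quadratic polynomial without constant term. Touching at \<open>(1, 0)\<close>, \<open>(-1, 0)\<close> and \<open>(0, 1)\<close> selects the largest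
  mean, the smallest mean and the largest second moment.
\<close>

lemma dominated_moments:
  assumes f: "f \<in> BL n"
  obtains m1 m2 m3 m4 where
    "\<And>a1 a2 a3 a4. a1 * m1 + a2 * m2 + a3 * m3 + a4 * m4
        \<le> L (\<lambda>x. a1 * f x + a2 * f x ^ 2 + a3 * f x ^ 3 + a4 * f x ^ 4)"
    "d1 * m1 + d2 * m2 = L (\<lambda>x. d1 * f x + d2 * f x ^ 2)"
proof -
  define poly4 :: "real \<times> real \<times> real \<times> real \<Rightarrow> (nat \<Rightarrow> real) \<Rightarrow> real" where
    "poly4 = (\<lambda>(a1, a2, a3, a4) x. a1 * f x + a2 * f x ^ 2 + a3 * f x ^ 3 + a4 * f x ^ 4)"
  have BL: "poly4 a \<in> BL n" for a
    unfolding poly4_def by (cases a) (simp, intro BL_add BL_mult BL_const BL_power f)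
  have "sublinear (\<lambda>a. L (poly4 a))"
    unfolding sublinear_def
  proof (intro conjI allI impI)
    fix a b
    have "poly4 (a + b) = (\<lambda>x. poly4 a x + poly4 b x)"
      by (cases a; cases b) (simp add: poly4_def algebra_simps)
    then show "L (poly4 (a + b)) \<le> L (poly4 a) + L (poly4 b)" using L_add[OF BL BL] by simp
  next
    fix r :: real and a assume "r \<ge> 0"
    have "poly4 (r *\<^sub>R a) = (\<lambda>x. r * poly4 a x)"
      by (cases a) (simp add: poly4_def algebra_simps)
    then show "L (poly4 (r *\<^sub>R a)) = r * L (poly4 a)" using L_scale[OF BL \<open>r \<ge> 0\<close>] by simp
  qed
  from sublinear_dominates_linear[OF this, of "(d1, d2, 0, 0)"]
  obtain P where P: "linear P" "\<And>a. P a \<le> L (poly4 a)" "P (d1, d2, 0, 0) = L (poly4 (d1, d2, 0, 0))"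
    by blast
  define m1 m2 m3 m4 where "m1 = P (1, 0, 0, 0)" and "m2 = P (0, 1, 0, 0)"
    and "m3 = P (0, 0, 1, 0)" and "m4 = P (0, 0, 0, 1)"
  have lin: "P (a1, a2, a3, a4) = a1 * m1 + a2 * m2 + a3 * m3 + a4 * m4" for a1 a2 a3 a4
  proof -
    have "P (a1, a2, a3, a4) = P (a1 *\<^sub>R (1, 0, 0, 0) + a2 *\<^sub>R (0, 1, 0, 0)
        + a3 *\<^sub>R (0, 0, 1, 0) + a4 *\<^sub>R (0, 0, 0, 1))" by simp
    then show ?thesis
      unfolding linear_add[OF P(1)] linear_scale[OF P(1)] m1_def m2_def m3_def m4_def by simp
  qed
  show thesis
  proof
    show "a1 * m1 + a2 * m2 + a3 * m3 + a4 * m4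
        \<le> L (\<lambda>x. a1 * f x + a2 * f x ^ 2 + a3 * f x ^ 3 + a4 * f x ^ 4)" for a1 a2 a3 a4
      using P(2)[of "(a1, a2, a3, a4)"] unfolding lin by (simp add: poly4_def)
    show "d1 * m1 + d2 * m2 = L (\<lambda>x. d1 * f x + d2 * f x ^ 2)"
      using P(3) unfolding lin by (simp add: poly4_def)
  qed
qed

text \<open>
  The coefficient \<open>a1\<close> does not occur on the left: the first moment of \<open>f\<close> under the dominated functional is zero.
\<close>

definition dominated_central_moments :: "((nat \<Rightarrow> real) \<Rightarrow> real) \<Rightarrow> real \<Rightarrow> real \<Rightarrow> real \<Rightarrow> bool" where
  "dominated_central_moments f s t u \<longleftrightarrow> (\<forall>a1 a2 a3 a4.
     a2 * s + a3 * t + a4 * u \<le> L (\<lambda>x. a1 * f x + a2 * f x ^ 2 + a3 * f x ^ 3 + a4 * f x ^ 4))"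

lemma dominated_central_momentsD:
  "dominated_central_moments f s t u \<Longrightarrow>
     a2 * s + a3 * t + a4 * u \<le> L (\<lambda>x. a1 * f x + a2 * f x ^ 2 + a3 * f x ^ 3 + a4 * f x ^ 4)"
  unfolding dominated_central_moments_def by blast

text \<open>
  The moments of \<open>dominated_moments\<close> about their mean \<open>\<theta>\<close>, by expanding polynomials in \<open>f - \<theta>\<close>.
\<close>

lemma dominated_central_moments_exist:
  assumes f: "f \<in> BL n"
  obtains \<theta> s t u where "dominated_central_moments (\<lambda>x. f x - \<theta>) s t u"
    "d1 * \<theta> + d2 * (s + \<theta>\<^sup>2) = L (\<lambda>x. d1 * f x + d2 * f x ^ 2)"
proof -
  obtain m1 m2 m3 m4 where m:
    "\<And>a1 a2 a3 a4. a1 * m1 + a2 * m2 + a3 * m3 + a4 * m4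
        \<le> L (\<lambda>x. a1 * f x + a2 * f x ^ 2 + a3 * f x ^ 3 + a4 * f x ^ 4)"
    "d1 * m1 + d2 * m2 = L (\<lambda>x. d1 * f x + d2 * f x ^ 2)"
    using dominated_moments[OF f] by blast
  have "dominated_central_moments (\<lambda>x. f x - m1) (m2 - m1\<^sup>2) (m3 - 3 * m1 * m2 + 2 * m1 ^ 3)
      (m4 - 4 * m1 * m3 + 6 * m1\<^sup>2 * m2 - 3 * m1 ^ 4)"
    unfolding dominated_central_moments_def
  proof (intro allI)
    fix a1 a2 a3 a4 :: real
    define b0 where "b0 = a1 * - m1 + a2 * (- m1) ^ 2 + a3 * (- m1) ^ 3 + a4 * (- m1) ^ 4"
    define b1 where "b1 = a1 + 2 * a2 * - m1 + 3 * a3 * (- m1) ^ 2 + 4 * a4 * (- m1) ^ 3"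
    define b2 where "b2 = a2 + 3 * a3 * - m1 + 6 * a4 * (- m1) ^ 2"
    define b3 where "b3 = a3 + 4 * a4 * - m1"
    let ?q = "\<lambda>x. b1 * f x + b2 * f x ^ 2 + b3 * f x ^ 3 + a4 * f x ^ 4"
    have shift: "(\<lambda>x. a1 * (f x - m1) + a2 * (f x - m1) ^ 2 + a3 * (f x - m1) ^ 3 + a4 * (f x - m1) ^ 4)
        = (\<lambda>x. ?q x + b0)"
      using quartic_shift[of 0 a1 "- m1" _ a2 a3 a4] unfolding b0_def b1_def b2_def b3_def by simp
    have q: "?q \<in> BL n" by (intro BL_add BL_mult BL_const BL_power f)
    have "a2 * (m2 - m1\<^sup>2) + a3 * (m3 - 3 * m1 * m2 + 2 * m1 ^ 3)
        + a4 * (m4 - 4 * m1 * m3 + 6 * m1\<^sup>2 * m2 - 3 * m1 ^ 4)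
        = b1 * m1 + b2 * m2 + b3 * m3 + a4 * m4 + b0"
      unfolding b0_def b1_def b2_def b3_def by algebra
    also have "\<dots> \<le> L ?q + b0" using m(1) by simp
    also have "\<dots> = L (\<lambda>x. ?q x + b0)" by (rule L_add_const[OF q, symmetric])
    finally show "a2 * (m2 - m1\<^sup>2) + a3 * (m3 - 3 * m1 * m2 + 2 * m1 ^ 3)
        + a4 * (m4 - 4 * m1 * m3 + 6 * m1\<^sup>2 * m2 - 3 * m1 ^ 4)
      \<le> L (\<lambda>x. a1 * (f x - m1) + a2 * (f x - m1) ^ 2 + a3 * (f x - m1) ^ 3 + a4 * (f x - m1) ^ 4)"
      unfolding shift .
  qed
  then show thesis by (rule that) (use m(2) in simp)
qed

text \<open>
  Integrating out one summand by its own dominated functional turns a quartic polynomial of the longer sum into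
  a quartic polynomial of the shorter one, with coefficients changed by the moments of the summand. The
  recursion is the one for the moments of a sum of independent centred variables, so \<open>B\<close>, \<open>C\<close> and \<open>F\<close> are the
  second, third and fourth moments of such a sum. In particular the fourth moment is at most
  \<open>3 B\<^sup>2\<close> plus the sum of the fourth moments of the summands.
\<close>

lemma dominated_moments_sum:
  assumes BL: "\<And>k. (\<lambda>x. \<beta> k (x k)) \<in> BL (Suc k)"
    and dom: "\<And>k. dominated_central_moments (\<lambda>x. \<beta> k (x k)) (s k) (t k) (u k)"
    and s: "\<And>k. 0 \<le> s k" and u: "\<And>k. u k \<le> K * s k" and "K \<ge> 0"
    and B: "B = (\<Sum>k=m..<m + j. s k)"
  obtains C F where "F \<le> 3 * B\<^sup>2 + K * B"
    "\<And>a0 a1 a2 a3 a4. a0 + a2 * B + a3 * C + a4 * F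
      \<le> L (\<lambda>x. a0 + a1 * block_sum \<beta> m j x + a2 * block_sum \<beta> m j x ^ 2
                + a3 * block_sum \<beta> m j x ^ 3 + a4 * block_sum \<beta> m j x ^ 4)"
proof -
  have "\<exists>C F. F \<le> 3 * B\<^sup>2 + K * B \<and> (\<forall>a0 a1 a2 a3 a4. a0 + a2 * B + a3 * C + a4 * F
      \<le> L (\<lambda>x. a0 + a1 * block_sum \<beta> m j x + a2 * block_sum \<beta> m j x ^ 2
                + a3 * block_sum \<beta> m j x ^ 3 + a4 * block_sum \<beta> m j x ^ 4))"
    using B
  proof (induction j arbitrary: B)
    case 0
    then show ?case by (auto intro!: exI[of _ 0] simp: block_sum_def L_const)
  next
    case (Suc j)
    define B0 where "B0 = (\<Sum>k=m..<m + j. s k)"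
    obtain C F where F: "F \<le> 3 * B0\<^sup>2 + K * B0" and ih: "\<forall>a0 a1 a2 a3 a4. a0 + a2 * B0 + a3 * C + a4 * F
      \<le> L (\<lambda>x. a0 + a1 * block_sum \<beta> m j x + a2 * block_sum \<beta> m j x ^ 2
                + a3 * block_sum \<beta> m j x ^ 3 + a4 * block_sum \<beta> m j x ^ 4)"
      using Suc.IH[OF B0_def] by (elim exE conjE) (rule that)
    define s' t' u' where "s' = s (m + j)" and "t' = t (m + j)" and "u' = u (m + j)"
    have B: "B = B0 + s'" using Suc.prems by (simp add: B0_def s'_def)
    have s': "0 \<le> s'" and B0: "0 \<le> B0" using s by (auto simp: s'_def B0_def intro: sum_nonneg)
    show ?case
    proof (rule exI[of _ "C + t'"], rule exI[of _ "F + 6 * B0 * s' + u'"], intro conjI allI)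
      have "u' \<le> K * s'" using u by (simp add: u'_def s'_def)
      moreover have "3 * B0\<^sup>2 + 6 * B0 * s' \<le> 3 * B\<^sup>2"
        unfolding B by (simp add: power2_sum algebra_simps)
      ultimately show "F + 6 * B0 * s' + u' \<le> 3 * B\<^sup>2 + K * B"
        using F unfolding B by (simp add: algebra_simps)
    next
      fix a0 a1 a2 a3 a4 :: real
      let ?N = "block_sum \<beta> m j" and ?N' = "block_sum \<beta> m (Suc j)" and ?b = "\<lambda>z. \<beta> (m + j) (z (m + j))"
      define b0 where "b0 = a0 + a2 * s' + a3 * t' + a4 * u'"
      define b1 where "b1 = a1 + 3 * a3 * s' + 4 * a4 * t'"
      define b2 where "b2 = a2 + 6 * a4 * s'"
      have N: "?N \<in> BL (m + j)" by (rule BL_block_sum[OF BL])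
      have N': "?N' \<in> BL (Suc (m + j))" using BL_block_sum[OF BL, of m "Suc j"] by simp
      have "b0 + b2 * B0 + a3 * C + a4 * F
          \<le> L (\<lambda>x. b0 + b1 * ?N x + b2 * ?N x ^ 2 + a3 * ?N x ^ 3 + a4 * ?N x ^ 4)"
        by (rule ih[rule_format])
      also have "\<dots> \<le> L (\<lambda>x. a0 + a1 * ?N' x + a2 * ?N' x ^ 2 + a3 * ?N' x ^ 3 + a4 * ?N' x ^ 4)"
      proof (rule L_tower_ge)
        show "(\<lambda>x. a0 + a1 * ?N' x + a2 * ?N' x ^ 2 + a3 * ?N' x ^ 3 + a4 * ?N' x ^ 4) \<in> BL (Suc (m + j))"
          by (intro BL_add BL_mult BL_const BL_power N')
        show "(\<lambda>x. b0 + b1 * ?N x + b2 * ?N x ^ 2 + a3 * ?N x ^ 3 + a4 * ?N x ^ 4) \<in> BL (m + j)"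
          by (intro BL_add BL_mult BL_const BL_power N)
        fix x :: "nat \<Rightarrow> real"
        define w where "w = ?N x"
        have eq: "?N' (x(m + j := v)) = w + \<beta> (m + j) v" for v
          using BL_update[OF N, of x v] by (simp add: block_sum_def w_def)
        define c0 where "c0 = a0 + a1 * w + a2 * w ^ 2 + a3 * w ^ 3 + a4 * w ^ 4"
        define c1 where "c1 = a1 + 2 * a2 * w + 3 * a3 * w\<^sup>2 + 4 * a4 * w ^ 3"
        define c2 where "c2 = a2 + 3 * a3 * w + 6 * a4 * w\<^sup>2"
        define c3 where "c3 = a3 + 4 * a4 * w"
        let ?q = "\<lambda>z. c1 * ?b z + c2 * ?b z ^ 2 + c3 * ?b z ^ 3 + a4 * ?b z ^ 4"
        have "b0 + b1 * w + b2 * w ^ 2 + a3 * w ^ 3 + a4 * w ^ 4 = (c2 * s' + c3 * t' + a4 * u') + c0"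
          unfolding b0_def b1_def b2_def c0_def c1_def c2_def c3_def by algebra
        also have "c2 * s' + c3 * t' + a4 * u' \<le> L ?q"
          unfolding s'_def t'_def u'_def by (rule dominated_central_momentsD[OF dom])
        also have "L ?q + c0 = L (\<lambda>z. ?q z + c0)"
          by (rule L_add_const[symmetric, of _ "Suc (m + j)"])
             (intro BL_add BL_mult BL_const BL_power BL)
        also have "(\<lambda>z. ?q z + c0) = (\<lambda>z. a0 + a1 * (w + ?b z) + a2 * (w + ?b z) ^ 2
            + a3 * (w + ?b z) ^ 3 + a4 * (w + ?b z) ^ 4)"
          unfolding c0_def c1_def c2_def c3_def by (simp only: quartic_shift)
        finally show "b0 + b1 * ?N x + b2 * ?N x ^ 2 + a3 * ?N x ^ 3 + a4 * ?N x ^ 4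
            \<le> L (\<lambda>z. a0 + a1 * ?N' (x(m + j := z (m + j))) + a2 * ?N' (x(m + j := z (m + j))) ^ 2
              + a3 * ?N' (x(m + j := z (m + j))) ^ 3 + a4 * ?N' (x(m + j := z (m + j))) ^ 4)"
          unfolding eq w_def by simp
      qed
      finally show "a0 + a2 * B + a3 * (C + t') + a4 * (F + 6 * B0 * s' + u')
          \<le> L (\<lambda>x. a0 + a1 * ?N' x + a2 * ?N' x ^ 2 + a3 * ?N' x ^ 3 + a4 * ?N' x ^ 4)"
        unfolding b0_def b2_def B by (simp add: algebra_simps)
    qed
  qed
  then obtain C F where F: "F \<le> 3 * B\<^sup>2 + K * B" and ge: "\<forall>a0 a1 a2 a3 a4. a0 + a2 * B + a3 * C + a4 * F
      \<le> L (\<lambda>x. a0 + a1 * block_sum \<beta> m j x + a2 * block_sum \<beta> m j x ^ 2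
                + a3 * block_sum \<beta> m j x ^ 3 + a4 * block_sum \<beta> m j x ^ 4)"
    by (elim exE conjE) (rule that)
  show thesis by (rule that[OF F]) (rule ge[rule_format])
qed

text \<open>
  The hypothesis \<open>conc\<close> says that the sum lies within \<open>\<epsilon>\<close> of \<open>- D\<close> except on an event of upper probability at most
  \<open>1 / 20\<close>. If a conclusion failed, there would be a polynomial that is at most one everywhere, nonpositive near
  \<open>- D\<close>, and has expectation above \<open>1 / 20\<close> under the dominated moments, which is a contradiction. Suppose that
  \<open>B\<close> is large. If \<open>\<bar>D\<bar>\<close> is at most half the standard deviation, the polynomial detects
  that the sum often has size comparable to the standard deviation (a Paley--Zygmund argument, which is where
  the fourth moment is needed). Otherwise it detects that a centred sum cannot stay on one side of zero. If \<open>B\<close> is small, Chebyshev's inequality keeps the sum close to zero.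
\<close>

lemma concentrated_sum_bounds:
  assumes BL: "\<And>k. (\<lambda>x. \<beta> k (x k)) \<in> BL (Suc k)"
    and dom: "\<And>k. dominated_central_moments (\<lambda>x. \<beta> k (x k)) (s k) (t k) (u k)"
    and s: "\<And>k. 0 \<le> s k" and u: "\<And>k. u k \<le> K * s k" and "K \<ge> 0" and "\<epsilon> > 0"
    and B: "B = (\<Sum>k=m..<m + j. s k)"
    and conc: "\<And>f. f \<in> BL (m + j) \<Longrightarrow> (\<And>x. f x \<le> 1) \<Longrightarrow>
      (\<And>x. \<bar>block_sum \<beta> m j x + D\<bar> \<le> \<epsilon> \<Longrightarrow> f x \<le> 0) \<Longrightarrow> L f \<le> 1 / 20"
  shows "B \<le> max (64 * \<epsilon>\<^sup>2) K" and "B \<le> \<epsilon>\<^sup>2 / 2 \<Longrightarrow> \<bar>D\<bar> \<le> 2 * \<epsilon>"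
proof -
  let ?N = "block_sum \<beta> m j"
  have N: "?N \<in> BL (m + j)" by (rule BL_block_sum[OF BL])
  obtain C F where F: "F \<le> 3 * B\<^sup>2 + K * B" and ge: "\<And>a0 a1 a2 a3 a4. a0 + a2 * B + a3 * C + a4 * F
      \<le> L (\<lambda>x. a0 + a1 * ?N x + a2 * ?N x ^ 2 + a3 * ?N x ^ 3 + a4 * ?N x ^ 4)"
    by (rule dominated_moments_sum[OF BL dom s u \<open>K \<ge> 0\<close> B]) (rule that)
  have test: "a0 + a2 * B + a4 * F \<le> 1 / 20"
    if "\<And>v. a0 + a1 * v + a2 * v ^ 2 + a4 * v ^ 4 \<le> 1"
      and "\<And>v. \<bar>v + D\<bar> \<le> \<epsilon> \<Longrightarrow> a0 + a1 * v + a2 * v ^ 2 + a4 * v ^ 4 \<le> 0" for a0 a1 a2 a4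
  proof -
    have "L (\<lambda>x. a0 + a1 * ?N x + a2 * ?N x ^ 2 + a4 * ?N x ^ 4) \<le> 1 / 20"
      by (rule conc) (use that in \<open>auto intro!: BL_add BL_mult BL_power N\<close>)
    then show ?thesis using ge[where ?a3.0 = 0 and ?a0.0 = a0 and ?a1.0 = a1 and ?a2.0 = a2 and ?a4.0 = a4]
      by simp
  qed
  show "B \<le> max (64 * \<epsilon>\<^sup>2) K"
  proof (rule ccontr)
    assume "\<not> ?thesis"
    then have B1: "64 * \<epsilon>\<^sup>2 < B" and B2: "K < B" by auto
    have "B > 0" using B2 \<open>K \<ge> 0\<close> by simp
    define r where "r = sqrt B"
    have r: "r > 0" "r\<^sup>2 = B" using \<open>B > 0\<close> by (auto simp: r_def)
    have "(8 * \<epsilon>)\<^sup>2 < r\<^sup>2" unfolding r(2) using B1 by (simp add: power_mult_distrib)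
    then have "8 * \<epsilon> < r" using r(1) by (intro power_less_imp_less_base[of "8 * \<epsilon>" 2 r]) auto
    then have \<epsilon>r: "\<epsilon> < r / 8" by simp
    show False
    proof (cases "\<bar>D\<bar> \<le> r / 2")
      case True
      \<comment> \<open>In \<open>y = v\<^sup>2 / B\<close> the polynomial is \<open>7 / 8 - (1 - y / 8)\<^sup>2\<close>. Its expectation is at least \<open>1 / 16\<close>,
        because the fourth moment is at most \<open>4 B\<^sup>2\<close>.\<close>
      have "- 1 / 8 + 1 / (4 * B) * B + - 1 / (64 * B\<^sup>2) * F \<le> 1 / 20"
      proof (rule test[of _ 0])
        fix v :: real
        define y where "y = v\<^sup>2 / B"
        have eq: "- 1 / 8 + 0 * v + 1 / (4 * B) * v\<^sup>2 + - 1 / (64 * B\<^sup>2) * v ^ 4 = - 1 / 8 + y / 4 - y\<^sup>2 / 64"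
          unfolding y_def using \<open>B > 0\<close> by (simp add: field_simps power2_eq_square power4_eq_xxxx)
        have "0 \<le> (1 - y / 8)\<^sup>2" by simp
        then show "- 1 / 8 + 0 * v + 1 / (4 * B) * v\<^sup>2 + - 1 / (64 * B\<^sup>2) * v ^ 4 \<le> 1"
          unfolding eq by (simp add: power2_eq_square algebra_simps)
        assume "\<bar>v + D\<bar> \<le> \<epsilon>"
        then have "\<bar>v\<bar> \<le> 5 / 8 * r" using True \<epsilon>r by linarith
        then have "v\<^sup>2 \<le> (5 / 8 * r)\<^sup>2" by (metis abs_ge_zero power2_abs power_mono)
        then have "y \<le> 25 / 64" unfolding y_def power_mult_distrib r using \<open>B > 0\<close>
          by (simp add: field_simps power2_eq_square)
        moreover have "0 \<le> y\<^sup>2" by simp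
        ultimately show "- 1 / 8 + 0 * v + 1 / (4 * B) * v\<^sup>2 + - 1 / (64 * B\<^sup>2) * v ^ 4 \<le> 0"
          unfolding eq by linarith
      qed
      moreover have "F \<le> 4 * B\<^sup>2"
        using F mult_right_mono[OF less_imp_le[OF B2], of B] \<open>B > 0\<close>
        unfolding power2_eq_square by linarith
      then have "F / (64 * B\<^sup>2) \<le> 1 / 16" using \<open>B > 0\<close> by (simp add: field_simps)
      ultimately show False using \<open>B > 0\<close> by simp
    next
      case False
      define \<sigma> where "\<sigma> = sgn D"
      have \<sigma>: "\<sigma> * D = \<bar>D\<bar>" "\<sigma>\<^sup>2 = 1" "\<bar>\<sigma>\<bar> = 1"
        using False r by (auto simp: \<sigma>_def sgn_if power2_eq_square split: if_splits)
      \<comment> \<open>In \<open>y = \<sigma> v / sqrt B\<close> the polynomial is \<open>1 - (y - 4)\<^sup>2 / 18\<close>. Its expectation is at least \<open>1 / 18\<close>.\<close>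
      have "1 / 9 + - 1 / (18 * B) * B + 0 * F \<le> 1 / 20"
      proof (rule test[of _ "4 * \<sigma> / (9 * r)"])
        fix v :: real
        define y where "y = \<sigma> * v / r"
        have eq: "1 / 9 + 4 * \<sigma> / (9 * r) * v + - 1 / (18 * B) * v\<^sup>2 + 0 * v ^ 4 = 1 / 9 + 4 * y / 9 - y\<^sup>2 / 18"
          unfolding y_def using r \<sigma> by (simp add: power_divide power_mult_distrib)
        have "0 \<le> (y - 4)\<^sup>2" by simp
        then show "1 / 9 + 4 * \<sigma> / (9 * r) * v + - 1 / (18 * B) * v\<^sup>2 + 0 * v ^ 4 \<le> 1"
          unfolding eq by (simp add: power2_eq_square algebra_simps)
        assume "\<bar>v + D\<bar> \<le> \<epsilon>"
        then have "\<sigma> * (v + D) \<le> \<epsilon>" using \<sigma>(3) by (metis abs_le_D1 abs_mult mult_1)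
        then have "\<sigma> * v \<le> - 3 / 8 * r" using False \<epsilon>r \<sigma>(1) by (simp add: distrib_left)
        then have "y \<le> - 3 / 8" unfolding y_def using r by (simp add: field_simps)
        moreover have "0 \<le> y\<^sup>2" by simp
        ultimately show "1 / 9 + 4 * \<sigma> / (9 * r) * v + - 1 / (18 * B) * v\<^sup>2 + 0 * v ^ 4 \<le> 0"
          unfolding eq by linarith
      qed
      then show False using \<open>B > 0\<close> by simp
    qed
  qed
  show "\<bar>D\<bar> \<le> 2 * \<epsilon>" if small: "B \<le> \<epsilon>\<^sup>2 / 2"
  proof (rule ccontr)
    assume D: "\<not> ?thesis"
    \<comment> \<open>Outside the exceptional event \<open>\<bar>v\<bar> \<ge> \<epsilon>\<close>, so that \<open>1 - v\<^sup>2 / \<epsilon>\<^sup>2 \<le> 0\<close>.\<close>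
    have "1 + - 1 / \<epsilon>\<^sup>2 * B + 0 * F \<le> 1 / 20"
    proof (rule test[of _ 0])
      show "1 + 0 * v + - 1 / \<epsilon>\<^sup>2 * v\<^sup>2 + 0 * v ^ 4 \<le> 1" for v :: real by simp
      fix v assume "\<bar>v + D\<bar> \<le> \<epsilon>"
      then have "\<epsilon> \<le> \<bar>v\<bar>" using D by linarith
      then have "\<epsilon>\<^sup>2 \<le> v\<^sup>2" using \<open>\<epsilon> > 0\<close> by (metis less_imp_le power2_abs power_mono)
      then show "1 + 0 * v + - 1 / \<epsilon>\<^sup>2 * v\<^sup>2 + 0 * v ^ 4 \<le> 0" using \<open>\<epsilon> > 0\<close> by (simp add: field_simps)
    qed
    then show False using small \<open>\<epsilon> > 0\<close> zero_less_power[OF \<open>\<epsilon> > 0\<close>, of 2]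
      by (simp add: field_simps)
  qed
qed

text \<open>
  Late blocks of truncated variables have sums of size at most \<open>\<epsilon>\<close> except on an event of upper probability
  at most \<open>1 / 20\<close>. The event is not mentioned, so that the condition depends on the law alone: the functions \<open>f\<close> stand for
  those below its indicator.
\<close>

definition concentrated_tails :: "real \<Rightarrow> bool" where
  "concentrated_tails c \<longleftrightarrow> (\<forall>\<epsilon>>0. \<exists>n. \<forall>m\<ge>n. \<forall>j. \<forall>f\<in>BL (m + j). (\<forall>x. f x \<le> 1) \<longrightarrow>
     (\<forall>x. \<bar>\<Sum>k=m..<m + j. clamp c (x k)\<bar> \<le> \<epsilon> \<longrightarrow> f x \<le> 0) \<longrightarrow> L f \<le> 1 / 20)"

lemma dominated_mean_bounds:
  assumes "f \<in> BL n" "dominated_central_moments (\<lambda>x. f x - \<theta>) s t u"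
  shows "- L (\<lambda>x. - f x) \<le> \<theta>" "\<theta> \<le> L f"
  using dominated_central_momentsD[OF assms(2), where ?a1.0 = 1 and ?a2.0 = 0 and ?a3.0 = 0 and ?a4.0 = 0]
    dominated_central_momentsD[OF assms(2), where ?a1.0 = "-1" and ?a2.0 = 0 and ?a3.0 = 0 and ?a4.0 = 0]
    L_add_const[OF assms(1), of "- \<theta>"] L_add_const[OF BL_minus[OF assms(1)], of \<theta>]
  by (simp_all add: add.commute)

text \<open>
  The first bound of \<open>concentrated_sum_bounds\<close>, with a fixed \<open>\<epsilon>\<close>, bounds the partial sums of the variances.
  Once their tails are small, the second bound makes the partial sums of the means a Cauchy sequence.
  The truncated variables deviate from their mean by at most \<open>2 c\<close>, so the fourth moment of each is at most
  \<open>4 c\<^sup>2\<close> times its second moment.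
\<close>

lemma concentrated_imp_summable:
  assumes "c > 0" and conc: "concentrated_tails c"
    and dom: "\<And>k. dominated_central_moments (\<lambda>x. clamp c (x k) - \<theta> k) (s k) (t k) (u k)"
  shows "summable s" and "summable \<theta>"
proof -
  let ?\<beta> = "\<lambda>k v. clamp c v - \<theta> k"
  have y: "(\<lambda>x. clamp c (x k)) \<in> BL (Suc k)" for k by (rule BL_clamp) simp
  have BL: "(\<lambda>x. ?\<beta> k (x k)) \<in> BL (Suc k)" for k by (intro BL_diff y BL_const)
  have \<theta>: "\<bar>\<theta> k\<bar> \<le> c" for k
    using dominated_mean_bounds[OF y dom[of k]] L_clamp_bounds[OF \<open>c > 0\<close>, of k] by linarith
  have \<beta>2: "(?\<beta> k v)\<^sup>2 \<le> 4 * c\<^sup>2" for k v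
  proof -
    have "\<bar>?\<beta> k v\<bar> \<le> 2 * c" using \<theta>[of k] \<open>c > 0\<close> by linarith
    then have "(?\<beta> k v)\<^sup>2 \<le> (2 * c)\<^sup>2" by (metis abs_ge_zero power2_abs power_mono)
    then show ?thesis by (simp add: power_mult_distrib)
  qed
  have s: "0 \<le> s k" for k
  proof -
    have "L (\<lambda>x. 0 * ?\<beta> k (x k) + -1 * ?\<beta> k (x k) ^ 2 + 0 * ?\<beta> k (x k) ^ 3 + 0 * ?\<beta> k (x k) ^ 4)
        \<le> L (\<lambda>x. 0)"
      by (rule L_mono) (auto intro!: BL_add BL_mult BL_power BL)
    then show ?thesis
      using dominated_central_momentsD[OF dom[of k], where ?a1.0 = 0 and ?a2.0 = "-1" and ?a3.0 = 0 and ?a4.0 = 0]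
      by (simp add: L_const)
  qed
  have u: "u k \<le> 4 * c\<^sup>2 * s k" for k
  proof -
    have "?\<beta> k v ^ 4 = (?\<beta> k v)\<^sup>2 * (?\<beta> k v)\<^sup>2" for v by (simp flip: power_add)
    then have \<beta>4: "?\<beta> k v ^ 4 \<le> 4 * c\<^sup>2 * ?\<beta> k v ^ 2" for v
      using mult_right_mono[OF \<beta>2[of v k], of "(?\<beta> k v)\<^sup>2"] by simp
    have "L (\<lambda>x. 0 * ?\<beta> k (x k) + -(4 * c\<^sup>2) * ?\<beta> k (x k) ^ 2 + 0 * ?\<beta> k (x k) ^ 3 + 1 * ?\<beta> k (x k) ^ 4)
        \<le> L (\<lambda>x. 0)"
      by (rule L_mono[of _ "Suc k"], intro BL_add BL_mult BL_const BL_power BL, rule BL_const)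
         (use \<beta>4 in simp)
    then show ?thesis
      using dominated_central_momentsD[OF dom[of k], where ?a1.0 = 0 and ?a2.0 = "-(4 * c\<^sup>2)" and ?a3.0 = 0 and ?a4.0 = 1]
      by (simp add: L_const)
  qed
  have sum: "block_sum ?\<beta> m j x + (\<Sum>k=m..<m + j. \<theta> k) = (\<Sum>k=m..<m + j. clamp c (x k))" for m j x
    by (simp add: block_sum_def flip: sum.distrib)
  have tail: "\<exists>n. \<forall>m\<ge>n. \<forall>j. (\<Sum>k=m..<m + j. s k) \<le> max (64 * \<epsilon>\<^sup>2) (4 * c\<^sup>2) \<and>
     ((\<Sum>k=m..<m + j. s k) \<le> \<epsilon>\<^sup>2 / 2 \<longrightarrow> \<bar>\<Sum>k=m..<m + j. \<theta> k\<bar> \<le> 2 * \<epsilon>)" if "\<epsilon> > 0" for \<epsilon>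
  proof -
    obtain n where n: "\<forall>m\<ge>n. \<forall>j. \<forall>f\<in>BL (m + j). (\<forall>x. f x \<le> 1) \<longrightarrow>
      (\<forall>x. \<bar>\<Sum>k=m..<m + j. clamp c (x k)\<bar> \<le> \<epsilon> \<longrightarrow> f x \<le> 0) \<longrightarrow> L f \<le> 1 / 20"
      using conc[unfolded concentrated_tails_def, THEN spec, THEN mp, OF \<open>\<epsilon> > 0\<close>] by (elim exE) (rule that)
    show ?thesis
    proof (intro exI[of _ n] allI impI conjI)
      fix m j assume "n \<le> m"
      have *: "L f \<le> 1 / 20" if "f \<in> BL (m + j)" "\<And>x. f x \<le> 1"
        "\<And>x. \<bar>block_sum ?\<beta> m j x + (\<Sum>k=m..<m + j. \<theta> k)\<bar> \<le> \<epsilon> \<Longrightarrow> f x \<le> 0" for f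
        using n[THEN spec, THEN mp, OF \<open>n \<le> m\<close>, THEN spec, THEN bspec, OF that(1)] that(2,3)
        unfolding sum by simp
      have K: "0 \<le> 4 * c\<^sup>2" by simp
      show "(\<Sum>k=m..<m + j. s k) \<le> max (64 * \<epsilon>\<^sup>2) (4 * c\<^sup>2)"
        by (rule concentrated_sum_bounds(1)[OF BL dom s u K \<open>\<epsilon> > 0\<close> refl *])
      show "\<bar>\<Sum>k=m..<m + j. \<theta> k\<bar> \<le> 2 * \<epsilon>" if "(\<Sum>k=m..<m + j. s k) \<le> \<epsilon>\<^sup>2 / 2"
        by (rule concentrated_sum_bounds(2)[OF BL dom s u K \<open>\<epsilon> > 0\<close> refl * that])
    qed
  qed
  show "summable s"
  proof -
    obtain n where n: "\<And>j. (\<Sum>k=n..<n + j. s k) \<le> max (64 * 1\<^sup>2) (4 * c\<^sup>2)"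
      using tail[of 1] by auto
    have "summable (\<lambda>k. s (k + n))"
      by (rule summableI_nonneg_bounded[where x = "max (64 * 1\<^sup>2) (4 * c\<^sup>2)"])
         (use n s in \<open>auto simp: sum.atLeastLessThan_shift_0[of s n] lessThan_atLeast0 add.commute comp_def\<close>)
    then show ?thesis by (simp add: summable_iff_shift)
  qed
  then have Cauchy: "\<And>e. e > 0 \<Longrightarrow> \<exists>N. \<forall>m\<ge>N. \<forall>n. norm (\<Sum>k=m..<n. s k) < e"
    unfolding summable_Cauchy by auto
  show "summable \<theta>"
    unfolding summable_Cauchy
  proof (intro allI impI)
    fix e :: real assume "e > 0"
    define \<epsilon> where "\<epsilon> = e / 3"
    have "\<epsilon> > 0" using \<open>e > 0\<close> by (simp add: \<epsilon>_def)
    obtain N1 where N1: "\<And>m n. m \<ge> N1 \<Longrightarrow> norm (\<Sum>k=m..<n. s k) < \<epsilon>\<^sup>2 / 2"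
      using Cauchy[of "\<epsilon>\<^sup>2 / 2"] \<open>\<epsilon> > 0\<close> by auto
    obtain N2 where N2: "\<And>m j. m \<ge> N2 \<Longrightarrow> (\<Sum>k=m..<m + j. s k) \<le> \<epsilon>\<^sup>2 / 2 \<Longrightarrow> \<bar>\<Sum>k=m..<m + j. \<theta> k\<bar> \<le> 2 * \<epsilon>"
      using tail[OF \<open>\<epsilon> > 0\<close>] by blast
    show "\<exists>N. \<forall>m\<ge>N. \<forall>n. norm (\<Sum>k=m..<n. \<theta> k) < e"
    proof (intro exI[of _ "max N1 N2"] allI impI)
      fix m n assume m: "max N1 N2 \<le> m"
      show "norm (\<Sum>k=m..<n. \<theta> k) < e"
      proof (cases "m \<le> n")
        case True
        then have n: "m + (n - m) = n" by simp
        have "(\<Sum>k=m..<n. s k) \<le> \<epsilon>\<^sup>2 / 2" using N1[of m n] m by simp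
        then have "\<bar>\<Sum>k=m..<n. \<theta> k\<bar> \<le> 2 * \<epsilon>" using N2[of m "n - m"] m unfolding n by simp
        then show ?thesis using \<open>e > 0\<close> by (simp add: \<epsilon>_def)
      qed (use \<open>e > 0\<close> in simp)
    qed
  qed
qed

text \<open>
  The mean \<open>\<theta> k\<close> of the functional that maximises the second moment about \<open>\<mu> k\<close> need not be \<open>\<mu> k\<close>. The error
  \<open>(\<theta> k - \<mu> k)\<^sup>2\<close> is at most \<open>2 c\<close> times the gap between the largest and the smallest mean, and this gap is summable
  by the first two choices of functionals.
\<close>

lemma concentrated_imp_summable_means_and_variances:
  fixes c :: real
  defines "\<mu> \<equiv> \<lambda>k. L (\<lambda>x. clamp c (x k))"
  assumes "c > 0" and conc: "concentrated_tails c"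
  shows "summable \<mu>" and "summable (\<lambda>k. L (\<lambda>x. - clamp c (x k)))"
    and "summable (\<lambda>k. L (\<lambda>x. (clamp c (x k) - \<mu> k)\<^sup>2))"
proof -
  let ?Z = "\<lambda>k x. clamp c (x k) - \<mu> k"
  have y: "(\<lambda>x. clamp c (x k)) \<in> BL (Suc k)" for k by (rule BL_clamp) simp
  have Z: "?Z k \<in> BL (Suc k)" for k by (intro BL_diff y BL_const)
  have sel: "\<exists>\<theta> s. (\<forall>k. d1 * (\<theta> k - \<mu> k) + d2 * (s k + (\<theta> k - \<mu> k)\<^sup>2) = L (\<lambda>x. d1 * ?Z k x + d2 * ?Z k x ^ 2))
      \<and> (\<forall>k. - L (\<lambda>x. - clamp c (x k)) \<le> \<theta> k) \<and> (\<forall>k. \<theta> k \<le> \<mu> k)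
      \<and> summable s \<and> summable \<theta>" for d1 d2
  proof -
    have "\<forall>k. \<exists>\<theta> s t u. dominated_central_moments (\<lambda>x. clamp c (x k) - \<theta>) s t u
        \<and> d1 * (\<theta> - \<mu> k) + d2 * (s + (\<theta> - \<mu> k)\<^sup>2) = L (\<lambda>x. d1 * ?Z k x + d2 * ?Z k x ^ 2)"
    proof
      fix k
      obtain m1 s t u where m1: "dominated_central_moments (\<lambda>x. ?Z k x - m1) s t u"
        "d1 * m1 + d2 * (s + m1\<^sup>2) = L (\<lambda>x. d1 * ?Z k x + d2 * ?Z k x ^ 2)"
        by (rule dominated_central_moments_exist[OF Z])
      show "\<exists>\<theta> s t u. dominated_central_moments (\<lambda>x. clamp c (x k) - \<theta>) s t u
        \<and> d1 * (\<theta> - \<mu> k) + d2 * (s + (\<theta> - \<mu> k)\<^sup>2) = L (\<lambda>x. d1 * ?Z k x + d2 * ?Z k x ^ 2)"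
        by (rule exI[of _ "\<mu> k + m1"], rule exI[of _ s], rule exI[of _ t], rule exI[of _ u])
           (use m1 in \<open>simp add: diff_diff_eq\<close>)
    qed
    then obtain \<theta> s t u where sel: "\<forall>k. dominated_central_moments (\<lambda>x. clamp c (x k) - \<theta> k) (s k) (t k) (u k)
        \<and> d1 * (\<theta> k - \<mu> k) + d2 * (s k + (\<theta> k - \<mu> k)\<^sup>2) = L (\<lambda>x. d1 * ?Z k x + d2 * ?Z k x ^ 2)"
      unfolding choice_iff by (elim exE) (rule that)
    have dom: "dominated_central_moments (\<lambda>x. clamp c (x k) - \<theta> k) (s k) (t k) (u k)"
      and eq: "d1 * (\<theta> k - \<mu> k) + d2 * (s k + (\<theta> k - \<mu> k)\<^sup>2) = L (\<lambda>x. d1 * ?Z k x + d2 * ?Z k x ^ 2)" for k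
      using spec[OF sel, of k] by simp_all
    show ?thesis
      by (rule exI[of _ \<theta>], rule exI[of _ s])
         (use eq dominated_mean_bounds[OF y dom] concentrated_imp_summable[OF \<open>c > 0\<close> conc dom] in
           \<open>simp add: \<mu>_def\<close>)
  qed
  have LZ: "L (?Z k) = 0" for k
    using L_add_const[OF y, of k "- \<mu> k"] by (simp add: \<mu>_def)
  have LZ': "L (\<lambda>x. - ?Z k x) = L (\<lambda>x. - clamp c (x k)) + \<mu> k" for k
    using L_add_const[OF BL_minus[OF y], of k "\<mu> k"] by (simp add: algebra_simps)
  obtain \<theta> where "\<And>k. \<theta> k - \<mu> k = L (?Z k)" "summable \<theta>" using sel[of 1 0] by auto
  moreover from this(1) have "\<theta> = \<mu>" using LZ by (simp add: fun_eq_iff)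
  ultimately show \<mu>: "summable \<mu>" by simp
  obtain \<theta> where \<nu>_eq: "\<And>k. \<mu> k - \<theta> k = L (\<lambda>x. - ?Z k x)" and "summable \<theta>"
    using sel[of "-1" 0] by auto
  moreover have "L (\<lambda>x. - clamp c (x k)) = - \<theta> k" for k
    using LZ'[of k] \<nu>_eq[of k] by linarith
  ultimately show \<nu>: "summable (\<lambda>k. L (\<lambda>x. - clamp c (x k)))" by (simp add: summable_minus_iff)
  obtain \<theta> s where \<theta>: "\<And>k. s k + (\<theta> k - \<mu> k)\<^sup>2 = L (\<lambda>x. (?Z k x)\<^sup>2)" "summable s"
    "\<And>k. - L (\<lambda>x. - clamp c (x k)) \<le> \<theta> k" "\<And>k. \<theta> k \<le> \<mu> k"
    using sel[of 0 1] by auto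
  define \<delta> where "\<delta> k = \<mu> k + L (\<lambda>x. - clamp c (x k))" for k
  have le: "L (\<lambda>x. (?Z k x)\<^sup>2) \<le> s k + 2 * c * \<delta> k" for k
  proof -
    have "\<delta> k \<le> 2 * c" "\<bar>\<theta> k - \<mu> k\<bar> \<le> \<delta> k"
      using L_clamp_bounds[OF \<open>c > 0\<close>, of k] \<theta>(3,4)[of k] by (auto simp: \<delta>_def \<mu>_def)
    then have "\<bar>\<theta> k - \<mu> k\<bar> * \<bar>\<theta> k - \<mu> k\<bar> \<le> 2 * c * \<delta> k" by (intro mult_mono) auto
    then show ?thesis unfolding \<theta>(1)[symmetric] by (simp add: power2_eq_square)
  qed
  have "summable (\<lambda>k. s k + 2 * c * \<delta> k)"
    unfolding \<delta>_def by (intro summable_add summable_mult \<theta> \<mu> \<nu>)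
  then show "summable (\<lambda>k. L (\<lambda>x. (?Z k x)\<^sup>2))"
    by (rule summable_comparison_test'[where N = 0])
       (use le L_nonneg[OF BL_power[OF Z]] in auto)
qed

end

section \<open>The law of an independent sequence and its capacity\<close>

context sublinear_expectation_space
begin

abbreviation V :: "'a set \<Rightarrow> ereal" where
  "V \<equiv> upper_capacity M H E"

definition law :: "(nat \<Rightarrow> 'a \<Rightarrow> real) \<Rightarrow> ((nat \<Rightarrow> real) \<Rightarrow> real) \<Rightarrow> real" where
  "law X f = real_of_ereal (E (\<lambda>\<omega>. f (\<lambda>i. X i \<omega>)))"

lemma H_const: "(\<lambda>\<omega>. a) \<in> H"
  using H_comp[of 0 "\<lambda>_ _. 0" "\<lambda>_. a"] by (force simp: C_l_Lip_def intro: exI[of _ 1])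

lemma cylinder_in_H:
  assumes X: "range X \<subseteq> H" and f: "f \<in> BL n"
  shows "(\<lambda>\<omega>. f (\<lambda>i. X i \<omega>)) \<in> H"
proof (rule H_comp[where n = n and Z = X])
  obtain B C where C: "C \<ge> 0" "\<And>x y. \<bar>f x - f y\<bar> \<le> C * (\<Sum>i<n. \<bar>x i - y i\<bar>)"
    using BL_E[OF f] by metis
  have "\<bar>f x - f y\<bar> \<le> (C * n + 1) * (1 + enorm n x ^ 0 + enorm n y ^ 0) * enorm n (\<lambda>i. x i - y i)" for x y
  proof -
    have "(\<Sum>i<n. \<bar>x i - y i\<bar>) \<le> (\<Sum>i<n. enorm n (\<lambda>i. x i - y i))"
    proof (rule sum_mono)
      fix i assume "i \<in> {..<n}"
      then show "\<bar>x i - y i\<bar> \<le> enorm n (\<lambda>i. x i - y i)"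
        using member_le_L2_set[of "{..<n}" i "\<lambda>i. \<bar>x i - y i\<bar>"] by (simp add: L2_set_def)
    qed
    then have "C * (\<Sum>i<n. \<bar>x i - y i\<bar>) \<le> C * n * enorm n (\<lambda>i. x i - y i)"
      using C(1) by (simp add: mult_left_mono mult.assoc)
    also have "\<dots> \<le> (C * n + 1) * 3 * enorm n (\<lambda>i. x i - y i)"
      using C(1) by (intro mult_right_mono) (auto simp: algebra_simps)
    finally show ?thesis using C(2)[of x y] by simp
  qed
  moreover have "C * n + 1 > 0" using C(1) by (simp add: add_nonneg_pos)
  ultimately show "f \<in> C_l_Lip n" unfolding C_l_Lip_def by blast
qed (use X in auto)

lemma E_law:
  assumes X: "range X \<subseteq> H" and f: "f \<in> BL n"
  shows "E (\<lambda>\<omega>. f (\<lambda>i. X i \<omega>)) = ereal (law X f)"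
proof -
  obtain B where B: "\<And>x. \<bar>f x\<bar> \<le> B" using BL_E[OF f] by metis
  have "- B \<le> f x" "f x \<le> B" for x using B[of x] by linarith+
  then have "ereal (- B) \<le> E (\<lambda>\<omega>. f (\<lambda>i. X i \<omega>))" "E (\<lambda>\<omega>. f (\<lambda>i. X i \<omega>)) \<le> ereal B"
    unfolding E_const[symmetric] by (auto intro!: E_mono H_const cylinder_in_H[OF X f])
  then show ?thesis unfolding law_def by (cases "E (\<lambda>\<omega>. f (\<lambda>i. X i \<omega>))") auto
qed

text \<open>
  Independence supplies the identity for \<open>i \<ge> 1\<close>. For \<open>i = 0\<close> there is no past, and the outer expectation is that
  of a constant.
\<close>

lemma law_tower:
  assumes X: "range X \<subseteq> H" and indep: "independent_sequence E X" and f: "f \<in> BL (Suc i)"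
  shows "law X f = law X (\<lambda>x. law X (\<lambda>z. f (x(i := z i))))"
proof (cases "i = 0")
  case True
  have "f (x(0 := z 0)) = f z" for x z by (rule BL_cong[OF f]) (simp add: True)
  then show ?thesis unfolding True by (simp add: law_def E_const)
next
  case False
  define \<phi> where "\<phi> x y = f (x(i := y 0))" for x y :: "nat \<Rightarrow> real"
  obtain B C where f': "C \<ge> 0" "\<And>x. \<bar>f x\<bar> \<le> B" "\<And>x y. \<bar>f x - f y\<bar> \<le> C * (\<Sum>i<Suc i. \<bar>x i - y i\<bar>)"
    using BL_E[OF f] by metis
  have lip: "\<bar>\<phi> x y - \<phi> x' y'\<bar>
      \<le> (C * (i + 1)) * sqrt ((enorm i (\<lambda>j. x j - x' j))\<^sup>2 + (enorm 1 (\<lambda>j. y j - y' j))\<^sup>2)" for x y x' y'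
  proof -
    define r where "r = sqrt ((enorm i (\<lambda>j. x j - x' j))\<^sup>2 + (enorm 1 (\<lambda>j. y j - y' j))\<^sup>2)"
    have "\<bar>(x(i := y 0)) j - (x'(i := y' 0)) j\<bar> \<le> r" if "j < Suc i" for j
    proof (cases "j = i")
      case True
      have "\<bar>y 0 - y' 0\<bar> = enorm 1 (\<lambda>j. y j - y' j)" by (simp add: L2_set_def)
      also have "\<dots> \<le> r" unfolding r_def by (rule real_sqrt_sum_squares_ge2)
      finally show ?thesis using True by simp
    next
      case False
      then have "\<bar>x j - x' j\<bar> \<le> enorm i (\<lambda>j. x j - x' j)"
        using member_le_L2_set[of "{..<i}" j "\<lambda>i. \<bar>x i - x' i\<bar>"] that by (simp add: L2_set_def)
      also have "\<dots> \<le> r" unfolding r_def by (rule real_sqrt_sum_squares_ge1)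
      finally show ?thesis using False by simp
    qed
    then have "(\<Sum>j<Suc i. \<bar>(x(i := y 0)) j - (x'(i := y' 0)) j\<bar>) \<le> (\<Sum>j<Suc i. r)"
      by (intro sum_mono) simp
    then have "C * (\<Sum>j<Suc i. \<bar>(x(i := y 0)) j - (x'(i := y' 0)) j\<bar>) \<le> C * (\<Sum>j<Suc i. r)"
      using f'(1) by (rule mult_left_mono)
    then show ?thesis
      using f'(3)[of "x(i := y 0)" "x'(i := y' 0)"] unfolding \<phi>_def r_def[symmetric]
      by (simp add: algebra_simps)
  qed
  have "\<phi> \<in> C_b_Lip i 1"
    unfolding C_b_Lip_def mem_Collect_eq
  proof (rule conjI)
    show "\<exists>B. \<forall>x y. \<bar>\<phi> x y\<bar> \<le> B" unfolding \<phi>_def by (intro exI[of _ B] allI f'(2))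
  qed (rule exI, (rule allI)+, rule lip)
  moreover have "independent_to E 1 (\<lambda>_. X i) i X"
    using indep False unfolding independent_sequence_def by simp
  ultimately have "E (\<lambda>\<omega>. \<phi> (\<lambda>j. X j \<omega>) (\<lambda>_. X i \<omega>))
      = E (\<lambda>\<omega>. real_of_ereal (E (\<lambda>\<omega>'. \<phi> (\<lambda>j. X j \<omega>) (\<lambda>_. X i \<omega>'))))"
    unfolding independent_to_def by blast
  moreover have "(\<lambda>j. X j \<omega>)(i := X i \<omega>) = (\<lambda>j. X j \<omega>)" for \<omega> by auto
  ultimately show ?thesis by (simp add: law_def \<phi>_def)
qed

lemma iterated_expectation_law:
  assumes X: "range X \<subseteq> H" and indep: "independent_sequence E X"
  shows "iterated_expectation (law X)"
proof
  fix f g n assume fg: "f \<in> BL n" "g \<in> BL n"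
  show "law X f \<le> law X g" if "\<And>x. f x \<le> g x"
    using E_mono[OF cylinder_in_H[OF X fg(2)] cylinder_in_H[OF X fg(1)]] that
    by (simp add: E_law[OF X fg(1)] E_law[OF X fg(2)])
  show "law X (\<lambda>x. f x + g x) \<le> law X f + law X g"
    using E_subadd[OF cylinder_in_H[OF X fg(1)] cylinder_in_H[OF X fg(2)]]
    by (simp add: E_law[OF X fg(1)] E_law[OF X fg(2)] E_law[OF X BL_add[OF fg]])
next
  show "law X (\<lambda>x. a) = a" for a by (simp add: law_def E_const)
next
  show "law X (\<lambda>x. a * f x) = a * law X f" if "f \<in> BL n" "0 \<le> a" for f n a
    using E_scale[OF cylinder_in_H[OF X that(1)] that(2)]
    by (simp add: E_law[OF X that(1)] E_law[OF X BL_mult[OF BL_const that(1)]])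
next
  show "law X f = law X (\<lambda>x. law X (\<lambda>z. f (x(i := z i))))" if "f \<in> BL (Suc i)" for f i
    by (rule law_tower[OF X indep that])
qed

lemma V_le: "\<xi> \<in> H \<Longrightarrow> (\<And>\<omega>. \<omega> \<in> space M \<Longrightarrow> indicator A \<omega> \<le> \<xi> \<omega>) \<Longrightarrow> V A \<le> E \<xi>"
  unfolding upper_capacity_def by (rule Inf_lower) auto

lemma V_ge: "\<xi> \<in> H \<Longrightarrow> (\<And>\<omega>. \<omega> \<in> space M \<Longrightarrow> \<xi> \<omega> \<le> indicator A \<omega>) \<Longrightarrow> E \<xi> \<le> V A"
  unfolding upper_capacity_def by (rule Inf_greatest) (auto intro!: E_mono intro: order_trans)

lemma V_mono:
  assumes "A \<subseteq> B"
  shows "V A \<le> V B"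
  unfolding upper_capacity_def[of _ _ _ B]
proof (rule Inf_greatest, clarify)
  fix \<xi> assume \<xi>: "\<xi> \<in> H" "\<forall>\<omega>\<in>space M. indicator B \<omega> \<le> \<xi> \<omega>"
  have "indicator A \<omega> \<le> (indicator B \<omega> :: real)" for \<omega> using assms by (auto simp: indicator_def)
  then show "V A \<le> E \<xi>" using \<xi> by (intro V_le) (auto intro: order_trans)
qed

lemma V_nonneg: "0 \<le> V A"
  using V_ge[OF H_const[of 0], of A] E_const[of 0] by (simp add: zero_ereal_def indicator_def)

lemma V_empty: "V {} = 0"
  using V_le[OF H_const[of 0], of "{}"] E_const[of 0] V_nonneg[of "{}"] by (simp add: zero_ereal_def antisym)

lemma V_Un_le:
  assumes "countably_subadditive_capacity M V" "A \<in> sets M" "B \<in> sets M"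
  shows "V (A \<union> B) \<le> V A + V B"
proof -
  define D where "D n = (if n = 0 then A else if n = 1 then B else {})" for n :: nat
  have "V (\<Union>n. D n) \<le> (\<Sum>n. V (D n))"
    using assms(1)[unfolded countably_subadditive_capacity_def, THEN spec, of D] assms(2,3)
    by (auto simp: D_def)
  also have "(\<Sum>n. V (D n)) = (\<Sum>n\<in>{0, 1}. V (D n))"
    by (rule suminf_finite) (auto simp: D_def V_empty)
  also have "(\<Union>n. D n) = A \<union> B"
  proof
    show "(\<Union>n. D n) \<subseteq> A \<union> B" by (auto simp: D_def split: if_splits)
    show "A \<union> B \<subseteq> (\<Union>n. D n)" using UN_upper[of 0 UNIV D] UN_upper[of 1 UNIV D] by (auto simp: D_def)
  qed
  finally show ?thesis by (simp add: D_def)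
qed

text \<open>
  Countable subadditivity bounds the capacity of the upper limit by every tail of the series.
\<close>

lemma Borel_Cantelli:
  assumes sub: "countably_subadditive_capacity M V" and A: "\<And>n. A n \<in> sets M"
    and V: "\<And>n. V (A n) \<le> ereal (b n)" and b: "summable b"
  shows "V (\<Inter>m. \<Union>n. A (n + m)) = 0"
proof (rule antisym[OF _ V_nonneg])
  show "V (\<Inter>m. \<Union>n. A (n + m)) \<le> 0"
  proof (rule ereal_le_epsilon2)
    fix e :: real assume "e > 0"
    then obtain m where m: "norm (\<Sum>i. b (i + m)) < e"
      using suminf_exist_split[OF _ b] by blast
    have bm: "summable (\<lambda>n. b (n + m))" using b by (simp add: summable_iff_shift)
    have "V (\<Inter>m. \<Union>n. A (n + m)) \<le> V (\<Union>n. A (n + m))" by (rule V_mono) auto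
    also have "\<dots> \<le> (\<Sum>n. V (A (n + m)))"
      using sub[unfolded countably_subadditive_capacity_def, THEN spec, of "\<lambda>n. A (n + m)"] A by auto
    also have "\<dots> \<le> (\<Sum>n. ereal (b (n + m)))" by (rule suminf_le_pos) (use V V_nonneg in auto)
    also have "\<dots> = ereal (\<Sum>n. b (n + m))" by (rule suminf_ereal'[OF bm])
    also have "\<dots> \<le> ereal e" using m by simp
    finally show "V (\<Inter>m. \<Union>n. A (n + m)) \<le> 0 + ereal e" by simp
  qed
qed

lemma S2_iff:
  "S2 E X c \<longleftrightarrow> summable (\<lambda>k. law X (\<lambda>x. clamp c (x k))) \<and> summable (\<lambda>k. law X (\<lambda>x. - clamp c (x k)))"
  unfolding S2_def law_def trunc_def[abs_def] ..

lemma suminf_law_finite_iff: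
  assumes X: "range X \<subseteq> H" and indep: "independent_sequence E X"
    and f: "\<And>k. f k \<in> BL (Suc k)" "\<And>k x. 0 \<le> f k x"
  shows "(\<Sum>k. E (\<lambda>\<omega>. f k (\<lambda>i. X i \<omega>))) < \<infinity> \<longleftrightarrow> summable (\<lambda>k. law X (f k))"
proof -
  interpret iterated_expectation "law X" by (rule iterated_expectation_law[OF X indep])
  have "0 \<le> law X (f k)" for k by (rule L_nonneg[OF f])
  then show ?thesis
    unfolding E_law[OF X f(1)] using summable_ereal[of "\<lambda>k. law X (f k)"] by (auto simp: suminf_ereal')
qed

lemma S3_iff:
  fixes X :: "nat \<Rightarrow> 'a \<Rightarrow> real" and c :: real
  assumes X: "range X \<subseteq> H" and indep: "independent_sequence E X"
  defines "\<mu> \<equiv> \<lambda>k. law X (\<lambda>x. clamp c (x k))" and "\<nu> \<equiv> \<lambda>k. law X (\<lambda>x. - clamp c (x k))"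
  shows "S3 E X c \<longleftrightarrow> summable (\<lambda>k. law X (\<lambda>x. (clamp c (x k) - \<mu> k)\<^sup>2))
                  \<or> summable (\<lambda>k. law X (\<lambda>x. (clamp c (x k) + \<nu> k)\<^sup>2))"
proof -
  have y: "(\<lambda>x. clamp c (x k)) \<in> BL (Suc k)" for k by (rule BL_clamp) simp
  have "(\<Sum>k. E (\<lambda>\<omega>. (clamp c (X k \<omega>) - \<mu> k)\<^sup>2)) < \<infinity> \<longleftrightarrow> summable (\<lambda>k. law X (\<lambda>x. (clamp c (x k) - \<mu> k)\<^sup>2))"
    by (rule suminf_law_finite_iff[OF X indep]) (auto intro!: BL_power BL_diff y)
  moreover have "(\<Sum>k. E (\<lambda>\<omega>. (clamp c (X k \<omega>) + \<nu> k)\<^sup>2)) < \<infinity> \<longleftrightarrow> summable (\<lambda>k. law X (\<lambda>x. (clamp c (x k) + \<nu> k)\<^sup>2))"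
    by (rule suminf_law_finite_iff[OF X indep]) (auto intro!: BL_power BL_add y)
  ultimately show ?thesis
    unfolding S3_def \<mu>_def \<nu>_def law_def trunc_def[abs_def] by simp
qed

text \<open>
  Kolmogorov's inequality for the capacity of one finite block.
\<close>

lemma V_block_exceeds_le:
  assumes X: "range X \<subseteq> H" and indep: "independent_sequence E X"
    and BL: "\<And>k. (\<lambda>x. \<psi> k (x k)) \<in> BL (Suc k)" and neg: "\<And>k. law X (\<lambda>x. \<psi> k (x k)) \<le> 0"
    and "\<epsilon> > 0"
  shows "V {\<omega> \<in> space M. \<exists>i\<le>j. \<epsilon> \<le> (\<Sum>k=m..<m + i. \<psi> k (X k \<omega>))}
    \<le> ereal (4 / \<epsilon>\<^sup>2 * (\<Sum>k=m..<m + j. law X (\<lambda>x. (\<psi> k (x k))\<^sup>2)))"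
proof -
  interpret iterated_expectation "law X" by (rule iterated_expectation_law[OF X indep])
  obtain f where f: "f \<in> BL (m + j)" "\<And>x. 0 \<le> f x"
    "\<And>x i. i \<le> j \<Longrightarrow> \<epsilon> \<le> (\<Sum>k=m..<m + i. \<psi> k (x k)) \<Longrightarrow> 1 \<le> f x"
    "law X f \<le> 4 / \<epsilon>\<^sup>2 * (\<Sum>k=m..<m + j. law X (\<lambda>x. (\<psi> k (x k))\<^sup>2))"
    by (rule maximal_inequality[OF BL neg \<open>\<epsilon> > 0\<close>]) (rule that)
  have "V {\<omega> \<in> space M. \<exists>i\<le>j. \<epsilon> \<le> (\<Sum>k=m..<m + i. \<psi> k (X k \<omega>))} \<le> E (\<lambda>\<omega>. f (\<lambda>i. X i \<omega>))"
    by (rule V_le[OF cylinder_in_H[OF X f(1)]]) (use f(2,3) in \<open>auto simp: indicator_def\<close>)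
  also have "\<dots> \<le> ereal (4 / \<epsilon>\<^sup>2 * (\<Sum>k=m..<m + j. law X (\<lambda>x. (\<psi> k (x k))\<^sup>2)))"
    unfolding E_law[OF X f(1)] using f(4) by simp
  finally show ?thesis .
qed

end

section \<open>The three series theorem\<close>

context sublinear_expectation_space
begin

text \<open>
  Off the events \<open>U j\<close> and \<open>U' j\<close> the centred sums of block \<open>j\<close> are bounded from above and from below. The constant \<open>4\<close>
  in the bounds for their capacities comes from the maximal inequality with \<open>\<epsilon> = 2\<^sup>-\<^sup>j\<close>. Outside the upper limit of these events and of
  \<open>T j\<close>, the centred truncated series converges, the centring constants are summable, and all but finitely many
  terms are equal to their truncations.
\<close>

theorem three_series_sufficient:
  assumes sub: "countably_subadditive_capacity M V"
    and X: "range X \<subseteq> H" and indep: "independent_sequence E X"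
    and "c > 0" and S1: "S1 M V X c" and S2: "S2 E X c" and S3: "S3 E X c"
  shows "series_converges_as M V X"
proof -
  interpret iterated_expectation "law X" by (rule iterated_expectation_law[OF X indep])
  have Xm [measurable]: "X k \<in> borel_measurable M" for k using X H_measurable by blast
  define \<mu> where "\<mu> k = law X (\<lambda>x. clamp c (x k))" for k
  define \<nu> where "\<nu> k = law X (\<lambda>x. - clamp c (x k))" for k
  define \<psi> where "\<psi> k t = clamp c t - \<mu> k" for k t
  define \<psi>' where "\<psi>' k t = - clamp c t - \<nu> k" for k t
  have y: "(\<lambda>x. clamp c (x k)) \<in> BL (Suc k)" for k by (rule BL_clamp) simp
  have \<psi>: "(\<lambda>x. \<psi> k (x k)) \<in> BL (Suc k)" and \<psi>': "(\<lambda>x. \<psi>' k (x k)) \<in> BL (Suc k)" for k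
    unfolding \<psi>_def \<psi>'_def by (intro BL_diff BL_minus BL_const y)+
  have neg: "law X (\<lambda>x. \<psi> k (x k)) \<le> 0" "law X (\<lambda>x. \<psi>' k (x k)) \<le> 0" for k
    using L_add_const[OF y, of k "- \<mu> k"] L_add_const[OF BL_minus[OF y], of k "- \<nu> k"]
    by (simp_all add: \<psi>_def \<psi>'_def \<mu>_def \<nu>_def)
  have \<mu>: "summable \<mu>" and \<nu>: "summable \<nu>" using S2 unfolding S2_iff \<mu>_def \<nu>_def by blast+
  have "\<psi>' k t ^ 2 = (clamp c t + \<nu> k)\<^sup>2" for k t
    unfolding \<psi>'_def by (simp add: power2_eq_square algebra_simps)
  then have var: "summable (\<lambda>k. law X (\<lambda>x. (\<psi> k (x k))\<^sup>2))" "summable (\<lambda>k. law X (\<lambda>x. (\<psi>' k (x k))\<^sup>2))"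
    using summable_variances[OF \<open>c > 0\<close>, folded \<mu>_def \<nu>_def] \<mu> \<nu> S3
    unfolding S3_iff[OF X indep] \<psi>_def \<mu>_def \<nu>_def by simp_all
  define \<delta> where "\<delta> k = \<mu> k + \<nu> k" for k
  have \<delta>0: "0 \<le> \<delta> k" for k
    using L_add[OF y BL_minus[OF y], of k] by (simp add: \<delta>_def \<mu>_def \<nu>_def L_const)
  define v v' where "v k = law X (\<lambda>x. (\<psi> k (x k))\<^sup>2)" and "v' k = law X (\<lambda>x. (\<psi>' k (x k))\<^sup>2)" for k
  have v0: "0 \<le> v k" "0 \<le> v' k" for k
    unfolding v_def v'_def by (rule L_nonneg[OF BL_power[OF \<psi>]] L_nonneg[OF BL_power[OF \<psi>']]; simp)+
  have "summable (\<lambda>k. v k + v' k + \<delta> k)"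
    unfolding \<delta>_def v_def v'_def by (intro summable_add \<mu> \<nu> var)
  then obtain n where n: "strict_mono n"
    "\<And>j l. (\<Sum>k=n j..<n j + l. v k + v' k + \<delta> k) \<le> (1 / 8) ^ j"
    by (rule summable_blocks) (rule that)
  have small: "(\<Sum>k=n j..<n j + l. v k) \<le> (1 / 8) ^ j" "(\<Sum>k=n j..<n j + l. v' k) \<le> (1 / 8) ^ j"
    "(\<Sum>k=n j..<n j + l. \<delta> k) \<le> (1 / 8) ^ j" for j l
    by (rule order_trans[OF sum_mono n(2)]; use v0 \<delta>0 in simp)+
  define l where "l j = n (Suc j) - n j" for j
  define U where "U j = {\<omega> \<in> space M. \<exists>i\<le>l j. (1 / 2) ^ j \<le> (\<Sum>k=n j..<n j + i. \<psi> k (X k \<omega>))}" for j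
  define U' where "U' j = {\<omega> \<in> space M. \<exists>i\<le>l j. (1 / 2) ^ j \<le> (\<Sum>k=n j..<n j + i. \<psi>' k (X k \<omega>))}" for j
  define T where "T j = {\<omega> \<in> space M. c < \<bar>X j \<omega>\<bar>}" for j
  have sets [measurable]: "U j \<in> sets M" "U' j \<in> sets M" "T j \<in> sets M" for j
    unfolding U_def U'_def T_def \<psi>_def \<psi>'_def by measurable
  have pow: "4 / ((1 / 2) ^ j)\<^sup>2 * (1 / 8) ^ j = 4 * (1 / 2 :: real) ^ j" for j
  proof -
    have "(1 / 8 :: real) ^ j = (1 / 2) ^ j * (1 / 2) ^ j * (1 / 2) ^ j"
      by (simp flip: power_mult_distrib)
    then show ?thesis by (simp add: power2_eq_square)
  qed
  have VU: "V (U j) \<le> ereal (4 * (1 / 2) ^ j)" for j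
  proof -
    have "V (U j) \<le> ereal (4 / ((1 / 2) ^ j)\<^sup>2 * (\<Sum>k=n j..<n j + l j. v k))"
      unfolding U_def v_def by (rule V_block_exceeds_le[OF X indep \<psi> neg(1)]) simp
    also have "\<dots> \<le> ereal (4 / ((1 / 2) ^ j)\<^sup>2 * (1 / 8) ^ j)"
      unfolding ereal_less_eq(3) by (intro mult_left_mono small) simp
    finally show ?thesis unfolding pow .
  qed
  have VU': "V (U' j) \<le> ereal (4 * (1 / 2) ^ j)" for j
  proof -
    have "V (U' j) \<le> ereal (4 / ((1 / 2) ^ j)\<^sup>2 * (\<Sum>k=n j..<n j + l j. v' k))"
      unfolding U'_def v'_def by (rule V_block_exceeds_le[OF X indep \<psi>' neg(2)]) simp
    also have "\<dots> \<le> ereal (4 / ((1 / 2) ^ j)\<^sup>2 * (1 / 8) ^ j)"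
      unfolding ereal_less_eq(3) by (intro mult_left_mono small) simp
    finally show ?thesis unfolding pow .
  qed
  have VT_fin: "(\<Sum>j. V (T j)) \<noteq> \<infinity>" using S1 unfolding S1_def T_def by simp
  define b where "b j = real_of_ereal (V (T j))" for j
  have VT: "V (T j) = ereal (b j)" for j
    using suminf_PInfty[OF _ VT_fin, of j] V_nonneg[of "T j"] V_nonneg unfolding b_def
    by (cases "V (T j)") auto
  have b: "summable b"
  proof (rule summable_ereal)
    show "0 \<le> b j" for j unfolding b_def by (rule real_of_ereal_pos[OF V_nonneg])
    show "(\<Sum>j. ereal (b j)) \<noteq> \<infinity>" using VT_fin unfolding VT .
  qed
  define N where "N = (\<Inter>m. \<Union>j. U (j + m) \<union> U' (j + m) \<union> T (j + m))"
  have "V N = 0"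
    unfolding N_def
  proof (rule Borel_Cantelli[OF sub])
    show "V (U j \<union> U' j \<union> T j) \<le> ereal (4 * (1 / 2) ^ j + 4 * (1 / 2) ^ j + b j)" for j
    proof -
      have "V (U j \<union> U' j \<union> T j) \<le> V (U j \<union> U' j) + V (T j)"
        by (rule V_Un_le[OF sub]) measurable
      also have "\<dots> \<le> V (U j) + V (U' j) + V (T j)"
        by (rule add_right_mono, rule V_Un_le[OF sub]) measurable
      also have "\<dots> \<le> ereal (4 * (1 / 2) ^ j) + ereal (4 * (1 / 2) ^ j) + ereal (b j)"
        by (intro add_mono VU VU') (simp add: VT)
      finally show ?thesis by simp
    qed
    show "summable (\<lambda>j. 4 * (1 / 2) ^ j + 4 * (1 / 2) ^ j + b j)"
      by (intro summable_add summable_mult summable_geometric b) auto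
  qed auto
  have conv: "(\<lambda>n. \<Sum>k<n. X k \<omega>) \<longlonglongrightarrow> (\<Sum>k. X k \<omega>)" if \<omega>: "\<omega> \<in> space M" "\<omega> \<notin> N" for \<omega>
  proof -
    obtain J where "\<omega> \<notin> (\<Union>j. U (j + J) \<union> U' (j + J) \<union> T (j + J))"
      using \<omega>(2) unfolding N_def by blast
    then have notJ: "\<omega> \<notin> U (j - J + J) \<union> U' (j - J + J) \<union> T (j - J + J)" for j by blast
    have J: "\<omega> \<notin> U j" "\<omega> \<notin> U' j" "\<omega> \<notin> T j" if "j \<ge> J" for j
      using notJ[of j] unfolding le_add_diff_inverse2[OF that] by simp_all
    define P where "P i = (\<Sum>k<i. \<psi> k (X k \<omega>))" for i
    have "convergent P"
    proof (rule convergent_of_block_bounds[OF n(1)])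
      show "summable (\<lambda>j. 2 * (1 / 2 :: real) ^ j)" by (intro summable_mult summable_geometric) auto
      show "0 \<le> 2 * (1 / 2 :: real) ^ j" for j by simp
      fix j i assume j: "j \<ge> J" and i: "i \<le> n (Suc j) - n j"
      have P: "P (n j + i) - P (n j) = (\<Sum>k=n j..<n j + i. \<psi> k (X k \<omega>))"
        unfolding P_def lessThan_atLeast0 using sum.atLeastLessThan_concat[of 0 "n j" "n j + i" "\<lambda>k. \<psi> k (X k \<omega>)"]
        by simp
      have up: "(\<Sum>k=n j..<n j + i. \<psi> k (X k \<omega>)) < (1 / 2) ^ j"
        using J(1)[OF j] i \<omega>(1) unfolding U_def l_def not_le[symmetric] by blast
      have "(\<Sum>k=n j..<n j + i. \<psi>' k (X k \<omega>)) < (1 / 2) ^ j"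
        using J(2)[OF j] i \<omega>(1) unfolding U'_def l_def not_le[symmetric] by blast
      moreover have "(\<Sum>k=n j..<n j + i. \<psi>' k (X k \<omega>))
          = - (\<Sum>k=n j..<n j + i. \<psi> k (X k \<omega>)) - (\<Sum>k=n j..<n j + i. \<delta> k)"
        by (simp add: \<psi>_def \<psi>'_def \<delta>_def flip: sum_subtractf sum_negf)
      moreover have "(\<Sum>k=n j..<n j + i. \<delta> k) \<le> (1 / 2) ^ j"
        by (rule order_trans[OF small(3)]) (simp add: power_mono)
      ultimately show "\<bar>P (n j + i) - P (n j)\<bar> \<le> 2 * (1 / 2) ^ j"
        using up unfolding P by linarith
    qed
    then have "summable (\<lambda>k. \<psi> k (X k \<omega>))" unfolding P_def summable_iff_convergent .
    from summable_add[OF this \<mu>] have "summable (\<lambda>k. clamp c (X k \<omega>))" by (simp add: \<psi>_def)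
    moreover have "\<forall>\<^sub>F k in sequentially. clamp c (X k \<omega>) = X k \<omega>"
    proof (rule eventually_sequentiallyI[of J])
      show "clamp c (X k \<omega>) = X k \<omega>" if "J \<le> k" for k
        using J(3)[OF that] \<omega>(1) by (auto simp: T_def)
    qed
    ultimately have "summable (\<lambda>k. X k \<omega>)" by (subst (asm) summable_cong)
    then show ?thesis by (rule summable_LIMSEQ)
  qed
  have "V {\<omega> \<in> space M. \<not> (\<lambda>n. \<Sum>k<n. X k \<omega>) \<longlonglongrightarrow> (\<Sum>k. X k \<omega>)} \<le> V N"
    by (rule V_mono) (use conv in blast)
  then show ?thesis
    unfolding series_converges_as_def using \<open>V N = 0\<close> V_nonneg
    by (intro bexI[of _ "\<lambda>\<omega>. \<Sum>k. X k \<omega>"] antisym) auto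
qed

text \<open>
  The events decrease to a set on which the partial sums are not Cauchy, which has capacity zero; continuity from
  above does the rest.
\<close>

lemma vanishing_oscillation:
  assumes cont: "continuous_capacity M V" and X: "range X \<subseteq> H"
    and conv: "series_converges_as M V X" and "\<epsilon> > 0" "\<eta> > 0"
  obtains m where "V {\<omega> \<in> space M. \<exists>k\<ge>m. \<exists>l\<ge>m. \<epsilon> < \<bar>(\<Sum>i<k. X i \<omega>) - (\<Sum>i<l. X i \<omega>)\<bar>} < ereal \<eta>"
proof -
  have Xm [measurable]: "X k \<in> borel_measurable M" for k using X H_measurable by blast
  define A where "A m = {\<omega> \<in> space M. \<exists>k\<ge>m. \<exists>l\<ge>m. \<epsilon> < \<bar>(\<Sum>i<k. X i \<omega>) - (\<Sum>i<l. X i \<omega>)\<bar>}" for m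
  obtain S where S: "V {\<omega> \<in> space M. \<not> (\<lambda>n. \<Sum>k<n. X k \<omega>) \<longlonglongrightarrow> S \<omega>} = 0"
    using conv unfolding series_converges_as_def by blast
  have "A m \<in> sets M" for m unfolding A_def by measurable
  moreover have "decseq A"
    unfolding decseq_def A_def by (auto intro: order_trans)
  ultimately have "(\<lambda>m. V (A m)) \<longlonglongrightarrow> V (\<Inter>m. A m)"
    using cont unfolding continuous_capacity_def by blast
  moreover have "(\<Inter>m. A m) \<subseteq> {\<omega> \<in> space M. \<not> (\<lambda>n. \<Sum>k<n. X k \<omega>) \<longlonglongrightarrow> S \<omega>}"
  proof
    fix \<omega> assume \<omega>: "\<omega> \<in> (\<Inter>m. A m)"
    have "\<not> Cauchy (\<lambda>n. \<Sum>k<n. X k \<omega>)"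
    proof
      assume "Cauchy (\<lambda>n. \<Sum>k<n. X k \<omega>)"
      from CauchyD[OF this \<open>\<epsilon> > 0\<close>]
      obtain m where m: "\<forall>k\<ge>m. \<forall>l\<ge>m. norm ((\<Sum>i<k. X i \<omega>) - (\<Sum>i<l. X i \<omega>)) < \<epsilon>" by blast
      have "\<omega> \<in> A m" using \<omega> by blast
      then obtain k l where "k \<ge> m" "l \<ge> m" "\<epsilon> < \<bar>(\<Sum>i<k. X i \<omega>) - (\<Sum>i<l. X i \<omega>)\<bar>"
        unfolding A_def by blast
      then show False using m[rule_format, of k l] by simp
    qed
    then show "\<omega> \<in> {\<omega> \<in> space M. \<not> (\<lambda>n. \<Sum>k<n. X k \<omega>) \<longlonglongrightarrow> S \<omega>}"
      using \<omega> LIMSEQ_imp_Cauchy[of "\<lambda>n. \<Sum>k<n. X k \<omega>" "S \<omega>"] unfolding A_def by blast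
  qed
  from V_mono[OF this] have "V (\<Inter>m. A m) = 0" unfolding S by (rule antisym[OF _ V_nonneg])
  ultimately have "\<forall>\<^sub>F m in sequentially. V (A m) < ereal \<eta>"
    using \<open>\<eta> > 0\<close> by (intro order_tendstoD(2)) auto
  then show thesis using that unfolding A_def eventually_sequentially by blast
qed

text \<open>
  Off the event \<open>A \<epsilon> n\<close> all terms and all block sums after time \<open>n\<close> have size at most \<open>\<epsilon>\<close>. If also \<open>\<epsilon> \<le> c\<close>, truncation
  does not change these terms, so their truncated block sums are small as well.
\<close>

theorem three_series_necessary:
  assumes X: "range X \<subseteq> H" and indep: "independent_sequence E X"
    and cont: "continuous_capacity M V" and conv: "series_converges_as M V X" and "c > 0"
  shows "S1 M V X c" "S2 E X c" "S3 E X c"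
proof -
  interpret iterated_expectation "law X" by (rule iterated_expectation_law[OF X indep])
  define A where "A \<epsilon> m = {\<omega> \<in> space M. \<exists>k\<ge>m. \<exists>l\<ge>m. \<epsilon> < \<bar>(\<Sum>i<k. X i \<omega>) - (\<Sum>i<l. X i \<omega>)\<bar>}" for \<epsilon> m
  have A_sum: "\<bar>\<Sum>k=m..<m + j. X k \<omega>\<bar> \<le> \<epsilon>" if "\<omega> \<in> space M" "\<omega> \<notin> A \<epsilon> n" "n \<le> m" for \<epsilon> n m j \<omega>
  proof -
    have "(\<Sum>k=m..<m + j. X k \<omega>) = (\<Sum>i<m + j. X i \<omega>) - (\<Sum>i<m. X i \<omega>)"
      unfolding lessThan_atLeast0 using sum.atLeastLessThan_concat[of 0 m "m + j" "\<lambda>k. X k \<omega>"] by simp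
    moreover have "\<bar>(\<Sum>i<k. X i \<omega>) - (\<Sum>i<l. X i \<omega>)\<bar> \<le> \<epsilon>" if "k \<ge> n" "l \<ge> n" for k l
      using \<open>\<omega> \<notin> A \<epsilon> n\<close> \<open>\<omega> \<in> space M\<close> that unfolding A_def mem_Collect_eq not_less[symmetric] by blast
    ultimately show ?thesis using \<open>n \<le> m\<close> by simp
  qed
  have A_term: "\<bar>X k \<omega>\<bar> \<le> \<epsilon>" if "\<omega> \<in> space M" "\<omega> \<notin> A \<epsilon> n" "n \<le> k" for \<epsilon> n k \<omega>
    using A_sum[OF that, of 1] by simp
  show "S1 M V X c"
  proof -
    obtain m where m: "V (A (c / 2) m) < ereal (1 / 2)"
      unfolding A_def
      by (rule vanishing_oscillation[OF cont X conv half_gt_zero[OF \<open>c > 0\<close>] half_gt_zero[OF zero_less_one]])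
    have "law X (\<lambda>x. 1 - (\<Prod>k=m..<m + j. 1 - excess c (x k))) \<le> 1 / 2" for j
    proof -
      have BL: "(\<lambda>x. 1 - (\<Prod>k=m..<m + j. 1 - excess c (x k))) \<in> BL (m + j)"
        by (intro BL_diff BL_const BL_prod BL_mono[OF BL_excess]) auto
      have "E (\<lambda>\<omega>. 1 - (\<Prod>k=m..<m + j. 1 - excess c (X k \<omega>))) \<le> V (A (c / 2) m)"
      proof (rule V_ge[OF cylinder_in_H[OF X BL]])
        fix \<omega> assume \<omega>: "\<omega> \<in> space M"
        have "0 \<le> (\<Prod>k=m..<m + j. 1 - excess c (X k \<omega>))"
          by (intro prod_nonneg) (use excess_props(2)[OF \<open>c > 0\<close>] in auto)
        moreover have "(\<Prod>k=m..<m + j. 1 - excess c (X k \<omega>)) = 1" if "\<omega> \<notin> A (c / 2) m"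
          by (rule prod.neutral) (use excess_props(4)[OF \<open>c > 0\<close>] A_term[OF \<omega> that] in auto)
        ultimately show "1 - (\<Prod>k=m..<m + j. 1 - excess c (X k \<omega>)) \<le> indicator (A (c / 2) m) \<omega>"
          by (auto simp: indicator_def)
      qed
      from le_less_trans[OF this m] show ?thesis unfolding E_law[OF X BL] by simp
    qed
    then have sum: "summable (\<lambda>k. law X (\<lambda>x. excess c (x k)))" by (rule summable_excess[OF \<open>c > 0\<close>])
    have "(\<Sum>k. V {\<omega> \<in> space M. c < \<bar>X k \<omega>\<bar>}) \<le> (\<Sum>k. ereal (law X (\<lambda>x. excess c (x k))))"
    proof (rule suminf_le_pos[OF _ V_nonneg])
      fix k
      show "V {\<omega> \<in> space M. c < \<bar>X k \<omega>\<bar>} \<le> ereal (law X (\<lambda>x. excess c (x k)))"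
        unfolding E_law[OF X BL_excess, symmetric]
        by (rule V_le[OF cylinder_in_H[OF X BL_excess]])
           (use excess_props(1,3)[OF \<open>c > 0\<close>] in \<open>auto simp: indicator_def\<close>)
    qed
    also have "\<dots> < \<infinity>" using suminf_ereal_finite[OF sum] by simp
    finally show ?thesis unfolding S1_def .
  qed
  have "concentrated_tails c"
    unfolding concentrated_tails_def
  proof (intro allI impI)
    fix \<epsilon> :: real assume "\<epsilon> > 0"
    define \<epsilon>' where "\<epsilon>' = min \<epsilon> c"
    have \<epsilon>': "\<epsilon>' > 0" "(0 :: real) < 1 / 20" using \<open>c > 0\<close> \<open>\<epsilon> > 0\<close> by (simp_all add: \<epsilon>'_def)
    obtain n where n: "V (A \<epsilon>' n) < ereal (1 / 20)"
      unfolding A_def by (rule vanishing_oscillation[OF cont X conv \<epsilon>'])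
    show "\<exists>n. \<forall>m\<ge>n. \<forall>j. \<forall>f\<in>BL (m + j). (\<forall>x. f x \<le> 1) \<longrightarrow>
     (\<forall>x. \<bar>\<Sum>k=m..<m + j. clamp c (x k)\<bar> \<le> \<epsilon> \<longrightarrow> f x \<le> 0) \<longrightarrow> law X f \<le> 1 / 20"
    proof (intro exI[of _ n] allI ballI impI)
      fix m j f assume m: "n \<le> m" and f: "f \<in> BL (m + j)" and f1: "\<forall>x. f x \<le> 1"
        and f0: "\<forall>x. \<bar>\<Sum>k=m..<m + j. clamp c (x k)\<bar> \<le> \<epsilon> \<longrightarrow> f x \<le> 0"
      have "E (\<lambda>\<omega>. f (\<lambda>i. X i \<omega>)) \<le> V (A \<epsilon>' n)"
      proof (rule V_ge[OF cylinder_in_H[OF X f]])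
        fix \<omega> assume \<omega>: "\<omega> \<in> space M"
        \<comment> \<open>Off the event the truncated block sum equals the original one, so \<open>f\<close> is nonpositive there.\<close>
        have "f (\<lambda>i. X i \<omega>) \<le> 0" if "\<omega> \<notin> A \<epsilon>' n"
        proof -
          have "clamp c (X k \<omega>) = X k \<omega>" if "k \<in> {m..<m + j}" for k
            using A_term[OF \<omega> \<open>\<omega> \<notin> A \<epsilon>' n\<close>, of k] that m unfolding \<epsilon>'_def by auto
          then have "(\<Sum>k=m..<m + j. clamp c (X k \<omega>)) = (\<Sum>k=m..<m + j. X k \<omega>)" by (rule sum.cong[OF refl])
          then show ?thesis using f0 A_sum[OF \<omega> that m, of j] unfolding \<epsilon>'_def by auto
        qed
        then show "f (\<lambda>i. X i \<omega>) \<le> indicator (A \<epsilon>' n) \<omega>" using f1 by (auto simp: indicator_def)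
      qed
      from le_less_trans[OF this n] show "law X f \<le> 1 / 20" unfolding E_law[OF X f] by simp
    qed
  qed
  note * = concentrated_imp_summable_means_and_variances[OF \<open>c > 0\<close> this]
  show "S2 E X c" unfolding S2_iff using *(1,2) by blast
  show "S3 E X c" unfolding S3_iff[OF X indep] using *(3) by blast
qed

end

theorem corollary3p1:
  fixes M :: "'a measure"
    and H :: "('a \<Rightarrow> real) set"
    and E :: "('a \<Rightarrow> real) \<Rightarrow> ereal"
    and X :: "nat \<Rightarrow> 'a \<Rightarrow> real"
  assumes "sublinear_expectation_space M H E"
    and "countably_subadditive_capacity M (upper_capacity M H E)"
    and "\<And>n. X n \<in> H"
    and "independent_sequence E X"
  shows "((\<exists>c>0. S1 M (upper_capacity M H E) X c \<and> S2 E X c \<and> S3 E X c) \<longrightarrow>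
            series_converges_as M (upper_capacity M H E) X) \<and>
         (continuous_capacity M (upper_capacity M H E) \<and>
          series_converges_as M (upper_capacity M H E) X \<longrightarrow>
            (\<forall>c>0. S1 M (upper_capacity M H E) X c \<and> S2 E X c \<and> S3 E X c))"
proof -
  interpret sublinear_expectation_space M H E by (rule assms(1))
  have X: "range X \<subseteq> H" using assms(3) by blast
  show ?thesis
    using three_series_sufficient[OF assms(2) X assms(4)] three_series_necessary[OF X assms(4)] by blast
qed

end
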